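(* Let $q$ be an integer with $q\equiv 3 \pmod 4$. Then neither an antipodal tight graph $\mathrm{AT4}(q^3-q^2-q,q,2)$ nor an antipodal tight graph $\mathrm{AT4}(q^3-2q,q,2)$ exists.
   Context: All graphs are finite and simple. A connected graph $\Gamma$ of diameter $d$ with distance function $\partial$ is distance-regular if for all $0\le i\le d$ and all vertices $x,y$ with $\partial(x,y)=i$ the numbers $a_i=|\Gamma_i(x)\cap\Gamma_1(y)|$, $b_i=|\Gamma_{i+1}(x)\cap\Gamma_1(y)|$, $c_i=|\Gamma_{i-1}(x)\cap\Gamma_1(y)|$ depend only on $i$, where $\Gamma_i(x)=\{y:\partial(x,y)=i\}$. Its valency is $k=b_0$. The local graph at $x$ is the subgraph induced on $\Gamma_1(x)$. Tight: let $\Gamma$ be distance-regular with diameter $d\ge3$ and eigenvalues $k=\theta_0>\theta_1>\dots>\theta_d$. Then $\Gamma$ is tight if it is not bipartite and $$\Big(\theta_1+\tfrac{k}{a_1+1}\Big)\Big(\theta_d+\tfrac{k}{a_1+1}\Big)=-\tfrac{ka_1b_1}{(a_1+1)^2}.$$ It is known that if $\Gamma$ is tight then every local graph is connected strongly regular with nontrivial eigenvalues (those other than the valency) $-1-b_1/(1+\theta_d)$ and $-1-b_1/(1+\theta_1)$. Antipodal: $\Gamma$ of diameter $d$ is antipodal if $\partial(x,y)=\partial(x,z)=d$ implies $y=z$ or $\partial(y,z)=d$; then being at distance $0$ or $d$ is an equivalence relation, whose classes are the antipodal classes, and $\Gamma$ is an antipodal $r$-cover if all classes have size $r$. An antipodal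 tight graph $\mathrm{AT4}(p,q,r)$ is a tight distance-regular graph of diameter $4$ that is an antipodal $r$-cover and whose local graphs have nontrivial eigenvalues $p$ and $-q$ with $p>-q$. It is known that then $p,q,r$ are integers with $p\ge1$, $q\ge2$, $r\ge2$, and that $\Gamma$ has intersection array $\{b_0,b_1,b_2,b_3;c_1,c_2,c_3,c_4\}=\{q(pq+p+q),(q^2-1)(p+1),(r-1)q(p+q)/r,1;\ 1,q(p+q)/r,(q^2-1)(p+1),q(pq+p+q)\}$. *)

theory Defs
  imports
    "HOL-Number_Theory.Cong"
    "Jordan_Normal_Form.Char_Poly"
    "Graph_Theory.Graph_Theory"
begin

text \<open>
  A finite simple graph is a digraph satisfying \<^locale>\<open>graph\<close>: finite, symmetric, loop-free
  and without parallel arcs.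
\<close>

section \<open>Distance-regular graphs\<close>

text \<open>The value is only meaningful if some walk from \<open>x\<close> to \<open>y\<close> exists.\<close>

definition graph_dist :: "('a, 'b) pre_digraph \<Rightarrow> 'a \<Rightarrow> 'a \<Rightarrow> nat" where
  "graph_dist G x y = (LEAST n. \<exists>p. pre_digraph.awalk G x p y \<and> length p = n)"

definition graph_diameter :: "('a, 'b) pre_digraph \<Rightarrow> nat" where
  "graph_diameter G = Max {graph_dist G x y | x y. x \<in> verts G \<and> y \<in> verts G}"

definition dist_sphere :: "('a, 'b) pre_digraph \<Rightarrow> nat \<Rightarrow> 'a \<Rightarrow> 'a set" where
  "dist_sphere G i x = {y \<in> verts G. graph_dist G x y = i}"

definition local_graph :: "('a, 'b) pre_digraph \<Rightarrow> 'a \<Rightarrow> ('a, 'b) pre_digraph" where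
  "local_graph G x = G \<restriction> dist_sphere G 1 x"

definition is_a :: "('a, 'b) pre_digraph \<Rightarrow> nat \<Rightarrow> nat \<Rightarrow> bool" where
  "is_a G i n \<longleftrightarrow> (\<forall>x\<in>verts G. \<forall>y\<in>verts G. graph_dist G x y = i \<longrightarrow>
     card (dist_sphere G i x \<inter> dist_sphere G 1 y) = n)"

definition is_b :: "('a, 'b) pre_digraph \<Rightarrow> nat \<Rightarrow> nat \<Rightarrow> bool" where
  "is_b G i n \<longleftrightarrow> (\<forall>x\<in>verts G. \<forall>y\<in>verts G. graph_dist G x y = i \<longrightarrow>
     card (dist_sphere G (i + 1) x \<inter> dist_sphere G 1 y) = n)"

text \<open>
  For \<open>i = 0\<close> the truncated \<open>i - 1\<close> is harmless: then \<open>y = x\<close>, and the spheres of radius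
  0 and 1 around \<open>x\<close> are disjoint, so the count is 0 just as for an empty sphere of radius -1.
\<close>

definition is_c :: "('a, 'b) pre_digraph \<Rightarrow> nat \<Rightarrow> nat \<Rightarrow> bool" where
  "is_c G i n \<longleftrightarrow> (\<forall>x\<in>verts G. \<forall>y\<in>verts G. graph_dist G x y = i \<longrightarrow>
     card (dist_sphere G (i - 1) x \<inter> dist_sphere G 1 y) = n)"

definition distance_regular :: "('a, 'b) pre_digraph \<Rightarrow> bool" where
  "distance_regular G \<longleftrightarrow> graph G \<and> Digraph_Component.connected G \<and>
     (\<forall>i\<le>graph_diameter G. (\<exists>n. is_a G i n) \<and> (\<exists>n. is_b G i n) \<and> (\<exists>n. is_c G i n))"

text \<open>In a distance-regular graph the numbers below are determined for \<open>i \<le> graph_diameter G\<close>.\<close>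

definition num_a :: "('a, 'b) pre_digraph \<Rightarrow> nat \<Rightarrow> nat" where
  "num_a G i = (THE n. is_a G i n)"

definition num_b :: "('a, 'b) pre_digraph \<Rightarrow> nat \<Rightarrow> nat" where
  "num_b G i = (THE n. is_b G i n)"

abbreviation drg_valency :: "('a, 'b) pre_digraph \<Rightarrow> nat" where
  "drg_valency G \<equiv> num_b G 0"

section \<open>Eigenvalues\<close>

text \<open>
  Matrices are indexed by \<open>{0..<n}\<close>, so the adjacency matrix needs an enumeration of the vertices.
  The choice is immaterial, since two enumerations give matrices conjugate by a permutation.
  The matrix is real symmetric, so all its eigenvalues are real.
\<close>

definition vertex_enum :: "('a, 'b) pre_digraph \<Rightarrow> 'a list" where
  "vertex_enum G = (SOME xs. distinct xs \<and> set xs = verts G)"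

definition adjacency_matrix :: "('a, 'b) pre_digraph \<Rightarrow> real mat" where
  "adjacency_matrix G = (let xs = vertex_enum G; n = length xs in
     mat n n (\<lambda>(i, j). if xs ! i \<rightarrow>\<^bsub>G\<^esub> xs ! j then 1 else 0))"

definition graph_eigenvalues :: "('a, 'b) pre_digraph \<Rightarrow> real set" where
  "graph_eigenvalues G = {t. eigenvalue (adjacency_matrix G) t}"

section \<open>Tight graphs and antipodal covers\<close>

definition bipartite :: "('a, 'b) pre_digraph \<Rightarrow> bool" where
  "bipartite G \<longleftrightarrow> (\<exists>U W. U \<union> W = verts G \<and> U \<inter> W = {} \<and>
     (\<forall>x y. x \<rightarrow>\<^bsub>G\<^esub> y \<longrightarrow> (x \<in> U \<and> y \<in> W) \<or> (x \<in> W \<and> y \<in> U)))"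

text \<open>
  The function \<open>\<theta>\<close> lists the distinct eigenvalues in decreasing order. Every distance-regular
  graph of diameter \<open>d\<close> has exactly \<open>d + 1\<close> of them, the largest being its valency,
  so such a \<open>\<theta>\<close> always exists and is unique on \<open>{..d}\<close>.
\<close>

definition tight :: "('a, 'b) pre_digraph \<Rightarrow> bool" where
  "tight G \<longleftrightarrow> distance_regular G \<and> graph_diameter G \<ge> 3 \<and> \<not> bipartite G \<and>
     (let d = graph_diameter G; k = real (drg_valency G);
          a1 = real (num_a G 1); b1 = real (num_b G 1)
      in \<exists>\<theta> :: nat \<Rightarrow> real. \<theta> 0 = k \<and> (\<forall>i<d. \<theta> (i + 1) < \<theta> i) \<and>
           graph_eigenvalues G = \<theta> ` {..d} \<and>
           (\<theta> 1 + k / (a1 + 1)) * (\<theta> d + k / (a1 + 1)) = - (k * a1 * b1 / (a1 + 1)\<^sup>2))"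

definition antipodal :: "('a, 'b) pre_digraph \<Rightarrow> bool" where
  "antipodal G \<longleftrightarrow> (\<forall>x\<in>verts G. \<forall>y\<in>verts G. \<forall>z\<in>verts G.
     graph_dist G x y = graph_diameter G \<longrightarrow> graph_dist G x z = graph_diameter G \<longrightarrow>
     y = z \<or> graph_dist G y z = graph_diameter G)"

definition antipodal_rel :: "('a, 'b) pre_digraph \<Rightarrow> 'a rel" where
  "antipodal_rel G = {(x, y). x \<in> verts G \<and> y \<in> verts G \<and>
     (graph_dist G x y = 0 \<or> graph_dist G x y = graph_diameter G)}"

definition antipodal_cover :: "('a, 'b) pre_digraph \<Rightarrow> nat \<Rightarrow> bool" where
  "antipodal_cover G r \<longleftrightarrow> antipodal G \<and> (\<forall>C \<in> verts G // antipodal_rel G. card C = r)"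

text \<open>
  The local graph at \<open>x\<close> is regular of valency \<open>num_a G 1\<close>, so its nontrivial eigenvalues are
  its eigenvalues other than \<open>num_a G 1\<close>.
\<close>

definition AT4 :: "('a, 'b) pre_digraph \<Rightarrow> real \<Rightarrow> real \<Rightarrow> nat \<Rightarrow> bool" where
  "AT4 G p q r \<longleftrightarrow> tight G \<and> graph_diameter G = 4 \<and> antipodal_cover G r \<and> p > - q \<and>
     (\<forall>x\<in>verts G. graph_eigenvalues (local_graph G x) - {real (num_a G 1)} = {p, - q})"

end

theory Submission
  imports Defs
begin

text \<open>
  In a graph \<open>AT4(p,q,2)\<close> the vertices fall into antipodal pairs \<open>x\<close>, \<open>ant x\<close>. Let \<open>P\<close> be the
  permutation matrix of the antipodal map and \<open>A\<close> the adjacency matrix. The matrix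
  \<open>B = (I - P) (A + q I)\<close> has the entries \<open>q, 1, 0, -1, -q\<close> at the distances \<open>0, 1, 2, 3, 4\<close>, and it is a
  multiple of an orthogonal projection (lemma \<open>B_B\<close>). Up to one common factor it is therefore the Gram matrix
  of its own rows: every antipodal pair becomes a line in a Euclidean space, and two vertices at distance 2 become
  orthogonal vectors. All counting below consists in finding linear relations between these vectors or their
  tensor squares. A relation is proved by expanding the squared norm of the combination and seeing that it is zero,
  so no spectral theorem is needed.

  The eigenvalue condition in the definition of tightness determines the intersection numbers in terms of \<open>p\<close>
  and \<open>q\<close> (\<open>tight_parameters\<close>), and then the local graphs are strongly regular with nontrivial eigenvalues
  \<open>p\<close> and \<open>-q\<close> (\<open>local_srg\<close>). In particular the common neighbours of two vertices at distance 2 induce a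
  graph that has \<open>q (p + q) / 2\<close> vertices and is regular of valency \<open>p\<close>.

  For \<open>p = q^3 - q^2 - q\<close> and \<open>q\<close> congruent to 3 modulo 4 both these numbers are odd, which is impossible.

  For \<open>p = q^3 - 2 q\<close> take three vertices \<open>x\<close>, \<open>z\<close>, \<open>w\<close> at mutual distance 2. The sum of the common
  neighbours of \<open>x\<close> and \<open>z\<close> is a multiple of \<open>x + z\<close> (\<open>sum_common_nbrs\<close>), hence orthogonal to \<open>w\<close>, so
  \<open>w\<close> and \<open>ant w\<close> have equally many neighbours among them. By symmetry, the antipodal pairs of vertices
  that are adjacent to all three of the pairs of \<open>x\<close>, \<open>z\<close>, \<open>w\<close> number \<open>4 e\<close>, where \<open>e\<close> counts the
  common neighbours of \<open>x\<close>, \<open>z\<close>, \<open>w\<close>. On the other hand, for exactly this value of \<open>p\<close> the tensor square of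
  \<open>z\<close> is a linear combination of the tensor squares of \<open>x\<close> and of the neighbours of \<open>x\<close>; taking the inner
  product with the tensor square of \<open>w\<close> gives \<open>4 e = q^2 (q - 1)\<close> (\<open>triple_intersection\<close>). For \<open>q\<close>
  congruent to 3 modulo 4 the right-hand side is not divisible by 4.
\<close>

section \<open>Antipodal double covers of diameter 4\<close>

text \<open>
  The distances in a double cover of diameter 4 can be read off from adjacency and the antipodal map: \<open>ant x\<close> is
  the vertex at distance 4 from \<open>x\<close>, the neighbours of \<open>ant x\<close> are those at distance 3, and whatever is left
  besides \<open>x\<close> and its neighbours is at distance 2. The numbers \<open>k\<close>, \<open>l\<close>, \<open>m\<close> are \<open>b_0\<close>, \<open>a_1\<close>, \<open>c_2\<close>.
\<close>

locale antipodal_double_cover =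
  fixes V :: "'a set" and adj :: "'a \<Rightarrow> 'a \<Rightarrow> bool" and ant :: "'a \<Rightarrow> 'a" and k l m :: nat
  assumes finite_V: "finite V"
    and adj_in: "adj x y \<Longrightarrow> x \<in> V"
    and adj_sym: "adj x y \<Longrightarrow> adj y x"
    and adj_irrefl: "\<not> adj x x"
    and ant_in: "x \<in> V \<Longrightarrow> ant x \<in> V"
    and ant_ant: "x \<in> V \<Longrightarrow> ant (ant x) = x"
    and ant_neq: "x \<in> V \<Longrightarrow> ant x \<noteq> x"
    and ant_adj: "adj x y \<Longrightarrow> adj (ant x) (ant y)"
    and not_adj_ant: "x \<in> V \<Longrightarrow> \<not> adj x (ant x)"
    and no_common_ant: "\<lbrakk>x \<in> V; adj x z\<rbrakk> \<Longrightarrow> \<not> adj (ant x) z"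
    and no_common_three: "\<lbrakk>x \<in> V; adj (ant x) y; adj x z\<rbrakk> \<Longrightarrow> \<not> adj y z"
    and card_nbrs: "x \<in> V \<Longrightarrow> card {z. adj x z} = k"
    and card_common_adj: "adj x y \<Longrightarrow> card {z. adj x z \<and> adj y z} = l"
    and card_common_two: "\<lbrakk>x \<in> V; y \<in> V; y \<noteq> x; y \<noteq> ant x; \<not> adj x y; \<not> adj (ant x) y\<rbrakk>
        \<Longrightarrow> card {z. adj x z \<and> adj y z} = m"
begin

definition nbrs :: "'a \<Rightarrow> 'a set" where "nbrs x = {y. adj x y}"

definition dist2 :: "'a \<Rightarrow> 'a \<Rightarrow> bool" where
  "dist2 x y \<longleftrightarrow> x \<in> V \<and> y \<in> V \<and> y \<noteq> x \<and> y \<noteq> ant x \<and> \<not> adj x y \<and> \<not> adj (ant x) y"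

lemma adj_in2: "adj x y \<Longrightarrow> y \<in> V"
  using adj_in adj_sym by blast

lemma adj_commute: "adj x y \<longleftrightarrow> adj y x"
  using adj_sym by blast

lemma in_nbrs [simp]: "y \<in> nbrs x \<longleftrightarrow> adj x y"
  by (simp add: nbrs_def)

lemma nbrs_subset: "nbrs x \<subseteq> V"
  using adj_in2 by auto

lemma finite_nbrs [simp]: "finite (nbrs x)"
  using nbrs_subset finite_V finite_subset by blast

lemma adj_ant_iff: "\<lbrakk>x \<in> V; y \<in> V\<rbrakk> \<Longrightarrow> adj (ant x) y \<longleftrightarrow> adj x (ant y)"
  using ant_adj ant_ant by metis

lemma ant_eq_iff: "\<lbrakk>x \<in> V; y \<in> V\<rbrakk> \<Longrightarrow> ant x = y \<longleftrightarrow> x = ant y"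
  using ant_ant by metis

lemma dist2_sym: "dist2 x y \<Longrightarrow> dist2 y x"
  unfolding dist2_def by (metis adj_commute adj_ant_iff ant_ant)

lemma dist2_ant: "dist2 x y \<Longrightarrow> dist2 x (ant y)"
  unfolding dist2_def by (metis adj_ant_iff ant_ant ant_in)

lemma dist2_common: "dist2 x y \<Longrightarrow> card (nbrs x \<inter> nbrs y) = m"
  using card_common_two[of x y] by (simp add: dist2_def nbrs_def Collect_conj_eq)

lemma adj_adj_dist2:
  assumes "adj y x" "adj y z" "x \<noteq> z" "\<not> adj x z"
  shows "dist2 x z"
  unfolding dist2_def using assms no_common_three[of x z y] no_common_ant[of y x] adj_sym adj_in2
    not_adj_ant no_common_ant[of x y] by metis

text \<open>
  With \<open>P\<close> the permutation matrix of the antipodal map, these are the entries of \<open>I - P\<close>, \<open>(I - P) A\<close>,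
  \<open>I + P\<close> and \<open>(I + P) A\<close>. The images of the first two consist of functions that are odd under the antipodal
  map, those of the last two of even functions.
\<close>

definition id_odd :: "'a \<Rightarrow> 'a \<Rightarrow> real" where "id_odd x y = of_bool (x = y) - of_bool (ant x = y)"
definition adj_odd :: "'a \<Rightarrow> 'a \<Rightarrow> real" where "adj_odd x y = of_bool (adj x y) - of_bool (adj (ant x) y)"
definition id_even :: "'a \<Rightarrow> 'a \<Rightarrow> real" where "id_even x y = of_bool (x = y) + of_bool (ant x = y)"
definition adj_even :: "'a \<Rightarrow> 'a \<Rightarrow> real" where "adj_even x y = of_bool (adj x y) + of_bool (adj (ant x) y)"

lemma sum_nbrs_adj: "(\<Sum>i\<in>nbrs x. of_bool (adj i y)) = (real (card (nbrs x \<inter> nbrs y)))"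
proof -
  have "nbrs x \<inter> {i. adj i y} = nbrs x \<inter> nbrs y" using adj_sym by auto
  thus ?thesis by (simp add: sum.If_cases of_bool_def)
qed

text \<open>
  This is \<open>A^2 = k I + l A + m A_2\<close>, where the matrix \<open>A_2\<close> of distance 2 has been expressed as what remains of
  the all-one matrix.
\<close>

lemma common:
  assumes "x \<in> V" "y \<in> V"
  shows "real (card (nbrs x \<inter> nbrs y)) = real k * of_bool (x = y) + real l * of_bool (adj x y)
     + real m * (1 - id_even x y - adj_even x y)"
proof -
  have c: "nbrs x \<inter> nbrs y = {z. adj x z \<and> adj y z}" by (auto simp: nbrs_def)
  consider "x = y" | "adj x y" | "y = ant x" | "adj (ant x) y" | "dist2 x y"
    using assms by (auto simp: dist2_def)
  thus ?thesis
  proof cases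
    case 1
    thus ?thesis using assms c card_nbrs[of x] adj_irrefl not_adj_ant[of x] ant_neq[of x]
      by (auto simp: id_even_def adj_even_def adj_commute)
  next
    case 2
    thus ?thesis using assms c card_common_adj[of x y] adj_irrefl no_common_ant[of x y]
      not_adj_ant[of x] by (auto simp: id_even_def adj_even_def adj_commute)
  next
    case 3
    have e: "nbrs x \<inter> nbrs y = {}" using no_common_ant[of x] 3 assms by auto
    show ?thesis using 3 assms not_adj_ant[of x] ant_neq[of x] adj_irrefl unfolding e
      by (auto simp: id_even_def adj_even_def)
  next
    case 4
    have e: "nbrs x \<inter> nbrs y = {}" using no_common_three[of x y] 4 assms by auto
    show ?thesis using 4 assms no_common_ant[of x] adj_irrefl not_adj_ant[of x] unfolding e
      by (auto simp: id_even_def adj_even_def adj_commute)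
  next
    case 5
    thus ?thesis using dist2_common[OF 5] unfolding dist2_def
      by (auto simp: id_even_def adj_even_def)
  qed
qed

lemma common_ant_arg:
  assumes "x \<in> V" "y \<in> V"
  shows "id_even x (ant y) = id_even x y" "adj_even x (ant y) = adj_even x y" "id_odd x (ant y) = - id_odd x y" "adj_odd x (ant y) = - adj_odd x y"
    "id_even (ant x) y = id_even x y" "adj_even (ant x) y = adj_even x y" "id_odd (ant x) y = - id_odd x y" "adj_odd (ant x) y = - adj_odd x y"
  using assms by (auto simp: id_even_def adj_even_def id_odd_def adj_odd_def adj_ant_iff ant_ant ant_in ant_eq_iff)

lemma op_sym:
  assumes "x \<in> V" "y \<in> V"
  shows "id_even x y = id_even y x" "adj_even x y = adj_even y x" "id_odd x y = id_odd y x" "adj_odd x y = adj_odd y x"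
proof -
  have "(ant x = y) = (ant y = x)" "adj (ant x) y = adj (ant y) x" "adj x y = adj y x"
    using ant_eq_iff[OF assms] adj_ant_iff[OF assms] adj_commute by auto
  thus "id_even x y = id_even y x" "adj_even x y = adj_even y x" "id_odd x y = id_odd y x" "adj_odd x y = adj_odd y x"
    by (simp_all add: id_even_def adj_even_def id_odd_def adj_odd_def eq_commute)
qed

lemma nbrs_ant_card:
  assumes "x \<in> V" "y \<in> V"
  shows "real (card (nbrs x \<inter> nbrs (ant y))) = real k * of_bool (ant x = y) + real l * of_bool (adj (ant x) y)
     + real m * (1 - id_even x y - adj_even x y)"
  using common[of x "ant y"] assms by (simp add: ant_in common_ant_arg adj_ant_iff ant_eq_iff)

lemma sum_nbrs_id_odd: assumes "x \<in> V" "y \<in> V" shows "(\<Sum>i\<in>nbrs x. id_odd i y) = adj_odd x y"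
  and sum_nbrs_id_even: "(\<Sum>i\<in>nbrs x. id_even i y) = adj_even x y"
proof -
  have 1: "(\<Sum>i\<in>nbrs x. of_bool (i = z)) = (of_bool (adj x z) :: real)" for z
    by (simp add: of_bool_def)
  have "(\<Sum>i\<in>nbrs x. of_bool (ant i = y)) = (of_bool (adj (ant x) y) :: real)"
  proof -
    have "(\<Sum>i\<in>nbrs x. of_bool (ant i = y)) = (\<Sum>i\<in>nbrs x. of_bool (i = ant y) :: real)"
      using assms by (intro sum.cong refl) (auto simp: ant_eq_iff adj_in2)
    thus ?thesis using 1 assms by (simp add: adj_ant_iff)
  qed
  thus "(\<Sum>i\<in>nbrs x. id_odd i y) = adj_odd x y" "(\<Sum>i\<in>nbrs x. id_even i y) = adj_even x y"
    by (simp_all add: id_odd_def adj_odd_def id_even_def adj_even_def sum_subtractf sum.distrib 1)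
qed

text \<open>
  Multiplication by \<open>A\<close>. On odd functions the all-one matrix and the distance-2 matrix vanish, which leaves the
  recursion \<open>A^2 = k I + l A\<close>.
\<close>

lemma sum_nbrs_adj_odd: assumes "x \<in> V" "y \<in> V" shows "(\<Sum>i\<in>nbrs x. adj_odd i y) = k * id_odd x y + l * adj_odd x y"
  and sum_nbrs_adj_even: "(\<Sum>i\<in>nbrs x. adj_even i y) = k * id_even x y + l * adj_even x y + 2 * m * (1 - id_even x y - adj_even x y)"
proof -
  have 1: "(\<Sum>i\<in>nbrs x. of_bool (adj (ant i) y)) = real (card (nbrs x \<inter> nbrs (ant y)))"
  proof -
    have "(\<Sum>i\<in>nbrs x. of_bool (adj (ant i) y)) = (\<Sum>i\<in>nbrs x. of_bool (adj i (ant y)) :: real)"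
      using assms by (intro sum.cong refl) (auto simp: adj_ant_iff adj_in2)
    thus ?thesis by (simp only: sum_nbrs_adj)
  qed
  show "(\<Sum>i\<in>nbrs x. adj_odd i y) = k * id_odd x y + l * adj_odd x y"
    "(\<Sum>i\<in>nbrs x. adj_even i y) = k * id_even x y + l * adj_even x y + 2 * m * (1 - id_even x y - adj_even x y)"
    unfolding id_odd_def adj_odd_def sum_subtractf 1 sum_nbrs_adj common[OF assms] nbrs_ant_card[OF assms]
    by (simp_all add: algebra_simps id_even_def adj_even_def sum.distrib 1 sum_nbrs_adj common[OF assms] nbrs_ant_card[OF assms])
qed

lemma sum_V_point: "x \<in> V \<Longrightarrow> (\<Sum>i\<in>V. of_bool (x = i) * f i) = (f x :: real)"
  using finite_V by (simp add: of_bool_def if_distrib[of "\<lambda>t. t * _"] cong: if_cong)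

lemma sum_V_adj: "(\<Sum>i\<in>V. of_bool (adj x i) * f i) = (sum f (nbrs x) :: real)"
proof -
  have "V \<inter> {i. adj x i} = nbrs x" using nbrs_subset by auto
  thus ?thesis using finite_V
    by (simp add: of_bool_def if_distrib[of "\<lambda>t. t * _"] sum.If_cases cong: if_cong)
qed

lemma sum_V_ops:
  assumes "x \<in> V"
  shows "(\<Sum>i\<in>V. id_odd x i * f i) = f x - f (ant x)"
    "(\<Sum>i\<in>V. adj_odd x i * f i) = sum f (nbrs x) - sum f (nbrs (ant x))"
    "(\<Sum>i\<in>V. id_even x i * f i) = f x + f (ant x)"
    "(\<Sum>i\<in>V. adj_even x i * f i) = sum f (nbrs x) + sum f (nbrs (ant x))"
  using assms ant_in unfolding id_odd_def adj_odd_def id_even_def adj_even_def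
  by (simp_all add: left_diff_distrib distrib_right sum_subtractf sum.distrib sum_V_point sum_V_adj)

lemma sum_V_nbrs: "(\<Sum>x\<in>V. \<Sum>y\<in>nbrs x. f y) = k * (\<Sum>y\<in>V. f y :: real)"
proof -
  have "(\<Sum>x\<in>V. \<Sum>y\<in>nbrs x. f y) = (\<Sum>x\<in>V. \<Sum>y\<in>V. of_bool (adj x y) * f y)"
    by (simp add: sum_V_adj)
  also have "\<dots> = (\<Sum>y\<in>V. f y * (\<Sum>x\<in>V. of_bool (adj y x) * 1))"
    by (subst sum.swap) (simp add: sum_distrib_left adj_commute mult.commute)
  also have "\<dots> = k * (\<Sum>y\<in>V. f y)"
    unfolding sum_V_adj using card_nbrs by (simp add: sum_distrib_left nbrs_def mult.commute)
  finally show ?thesis .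
qed

lemma sum_nbrs_nbrs:
  assumes "x \<in> V"
  shows "(\<Sum>y\<in>nbrs x. \<Sum>z\<in>nbrs y. f z) = (\<Sum>z\<in>V. real (card (nbrs x \<inter> nbrs z)) * f z)"
proof -
  have "(\<Sum>y\<in>nbrs x. \<Sum>z\<in>nbrs y. f z) = (\<Sum>y\<in>nbrs x. \<Sum>z\<in>V. of_bool (adj y z) * f z)"
    by (simp add: sum_V_adj)
  also have "\<dots> = (\<Sum>z\<in>V. (\<Sum>y\<in>nbrs x. of_bool (adj y z)) * f z)"
    by (subst sum.swap) (simp add: sum_distrib_right)
  finally show ?thesis by (simp only: sum_nbrs_adj)
qed

text \<open>
  If the eigenfunction \<open>f\<close> has a nonzero odd part, that part satisfies \<open>A^2 f = k f + l A f\<close>. Otherwise \<open>f\<close> is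
  even; either its sum is nonzero and then \<open>t\<close> is the valency, or the sum is zero and the distance-2 matrix acts on \<open>f\<close>
  as \<open>-2 (I + A)\<close>, which gives the second quadratic.
\<close>

lemma eigenvalue_cases:
  fixes f :: "'a \<Rightarrow> real" and t :: real
  assumes ev: "\<And>x. x \<in> V \<Longrightarrow> (\<Sum>y\<in>nbrs x. f y) = t * f x"
    and "x0 \<in> V" "f x0 \<noteq> 0"
  shows "t = real k \<or> t\<^sup>2 - real l * t - real k = 0 \<or>
    t\<^sup>2 - (real l - 2 * real m) * t - (real k - 2 * real m) = 0"
proof -
  have A2: "t\<^sup>2 * f x = (real k - m) * f x + (real l - m) * (t * f x) + m * (sum f V - f (ant x) - t * f (ant x))"
    if x: "x \<in> V" for x
  proof -
    have "t\<^sup>2 * f x = (\<Sum>y\<in>nbrs x. \<Sum>z\<in>nbrs y. f z)"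
      using ev nbrs_subset x by (simp add: subset_iff adj_in2 sum_distrib_left[symmetric] power2_eq_square)
    also have "\<dots> = (\<Sum>z\<in>V. (real k * of_bool (x = z) + real l * of_bool (adj x z) + m * (1 - id_even x z - adj_even x z)) * f z)"
      unfolding sum_nbrs_nbrs[OF x] using common[OF x] by (intro sum.cong) auto
    also have "\<dots> = k * (\<Sum>z\<in>V. of_bool (x = z) * f z) + l * (\<Sum>z\<in>V. of_bool (adj x z) * f z) +
         m * (sum f V - (\<Sum>z\<in>V. id_even x z * f z) - (\<Sum>z\<in>V. adj_even x z * f z))"
      by (simp add: algebra_simps sum.distrib sum_subtractf sum_distrib_left)
    also have "\<dots> = k * f x + l * (t * f x) + m * (sum f V - (f x + f (ant x)) - (t * f x + t * f (ant x)))"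
      using ev x ant_in[OF x] by (simp add: sum_V_point sum_V_adj sum_V_ops[OF x])
    finally show ?thesis by (simp add: algebra_simps)
  qed
  show ?thesis
  proof (cases "\<forall>x\<in>V. f (ant x) = f x")
    case False
    then obtain x where x: "x \<in> V" "f (ant x) \<noteq> f x" by auto
    have "(t\<^sup>2 - real l * t - real k) * (f x - f (ant x)) = 0"
      using A2[OF x(1)] A2[OF ant_in[OF x(1)]] by (simp add: ant_ant[OF x(1)] algebra_simps)
    thus ?thesis using x by simp
  next
    case True
    have "k * sum f V = t * sum f V"
      using sum_V_nbrs[of f] ev by (simp add: sum_distrib_left)
    show ?thesis
    proof (cases "sum f V = 0")
      case False
      thus ?thesis using \<open>k * sum f V = t * sum f V\<close> by simp
    next
      case z: True
      have "(t\<^sup>2 - (real l - 2 * real m) * t - (real k - 2 * real m)) * f x0 = 0"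
        using A2[OF assms(2)] True assms(2) by (simp add: z algebra_simps)
      thus ?thesis using assms by simp
    qed
  qed
qed

end

section \<open>Tight double covers and their local graphs\<close>

text \<open>
  Both sides are the squared norm of the sum over \<open>y\<close> of the tensors \<open>u y\<close> times \<open>v y\<close>; on the right it is expanded in
  the two Gram matrices. This form makes it visible that an entrywise product of Gram matrices is
  positive semidefinite, and its vanishing yields the vanishing of every coordinate.
\<close>

lemma sum_of_squares_Gram:
  fixes u v :: "'i \<Rightarrow> 'y \<Rightarrow> real"
  shows "(\<Sum>i\<in>I. \<Sum>j\<in>J. (\<Sum>y\<in>N. u i y * v j y)\<^sup>2) =
    (\<Sum>y\<in>N. \<Sum>z\<in>N. (\<Sum>i\<in>I. u i y * u i z) * (\<Sum>j\<in>J. v j y * v j z))"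
proof -
  have "(\<Sum>i\<in>I. \<Sum>j\<in>J. (\<Sum>y\<in>N. u i y * v j y)\<^sup>2) =
    (\<Sum>i\<in>I. \<Sum>j\<in>J. \<Sum>y\<in>N. \<Sum>z\<in>N. (u i y * u i z) * (v j y * v j z))"
    by (simp add: power2_eq_square sum_product mult_ac)
  also have "\<dots> = (\<Sum>i\<in>I. \<Sum>y\<in>N. \<Sum>j\<in>J. \<Sum>z\<in>N. (u i y * u i z) * (v j y * v j z))"
    by (intro sum.cong refl sum.swap)
  also have "\<dots> = (\<Sum>y\<in>N. \<Sum>i\<in>I. \<Sum>z\<in>N. \<Sum>j\<in>J. (u i y * u i z) * (v j y * v j z))"
    by (subst sum.swap) (intro sum.cong refl sum.swap)
  also have "\<dots> = (\<Sum>y\<in>N. \<Sum>z\<in>N. \<Sum>i\<in>I. \<Sum>j\<in>J. (u i y * u i z) * (v j y * v j z))"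
    by (intro sum.cong refl sum.swap)
  finally show ?thesis by (simp add: sum_product)
qed

lemma sum_squares_zero:
  fixes f :: "'i \<Rightarrow> 'j \<Rightarrow> real"
  assumes "finite I" "finite J" "(\<Sum>i\<in>I. \<Sum>j\<in>J. (f i j)\<^sup>2) = 0" "i \<in> I" "j \<in> J"
  shows "f i j = 0"
proof -
  have "(\<Sum>j\<in>J. (f i j)\<^sup>2) = 0"
    using assms sum_nonneg_eq_0_iff[of I "\<lambda>i. \<Sum>j\<in>J. (f i j)\<^sup>2"] by (auto simp: sum_nonneg)
  thus ?thesis using assms sum_nonneg_eq_0_iff[of J "\<lambda>j. (f i j)\<^sup>2"] by auto
qed

text \<open>
  The parameters of \<open>AT4(p,q,2)\<close> with \<open>s = q\<close> and \<open>\<tau> = p\<close>. The eigenvalues of the graph are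
  \<open>k > \<alpha> > \<tau> > -s > -s^2\<close>, with \<open>\<alpha>\<close> as below.
\<close>

locale tight_double_cover = antipodal_double_cover +
  fixes s \<tau> :: real
  assumes s_gt: "s > 1" and tau_ge: "\<tau> \<ge> 0"
    and l_eq: "real l = \<tau> * (s + 1)"
    and k_eq: "real k = s * (\<tau> * s + \<tau> + s)"
    and m_eq: "2 * real m = s * (\<tau> + s)"
begin

definition \<alpha> :: real where "\<alpha> = \<tau> * s + \<tau> + s"

lemma alpha: "real k = s * \<alpha>" "real l = \<alpha> - s" "\<alpha> > 0"
  using l_eq k_eq s_gt tau_ge by (auto simp: \<alpha>_def algebra_simps intro: add_nonneg_pos)

text \<open>
  The matrix \<open>(I - P) (A + s I)\<close>. On odd functions \<open>A\<close> has the eigenvalues \<open>\<alpha>\<close> and \<open>-s\<close>, so \<open>B\<close> is a multiple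
  of the orthogonal projection to the \<open>\<alpha>\<close>-eigenspace.
\<close>

definition B :: "'a \<Rightarrow> 'a \<Rightarrow> real" where "B x y = s * id_odd x y + adj_odd x y"

lemma B_sym: "x \<in> V \<Longrightarrow> y \<in> V \<Longrightarrow> B x y = B y x"
  by (simp add: B_def op_sym)

lemma B_ant: "x \<in> V \<Longrightarrow> y \<in> V \<Longrightarrow> B (ant x) y = - B x y" "x \<in> V \<Longrightarrow> y \<in> V \<Longrightarrow> B x (ant y) = - B x y"
  by (simp_all add: B_def common_ant_arg)

lemma sum_nbrs_B:
  assumes "x \<in> V" "y \<in> V"
  shows "(\<Sum>i\<in>nbrs x. B i y) = \<alpha> * B x y"
  using sum_nbrs_id_odd[OF assms] sum_nbrs_adj_odd[OF assms]
  by (simp add: B_def sum.distrib sum_distrib_left[symmetric] alpha algebra_simps)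

lemma B_B:
  assumes "x \<in> V" "y \<in> V"
  shows "(\<Sum>i\<in>V. B x i * B i y) = 2 * (\<alpha> + s) * B x y"
proof -
  have "(\<Sum>i\<in>V. B x i * B i y) = s * (\<Sum>i\<in>V. id_odd x i * B i y) + (\<Sum>i\<in>V. adj_odd x i * B i y)"
    unfolding B_def[of x] by (simp add: algebra_simps sum.distrib sum_distrib_left)
  also have "\<dots> = 2 * (\<alpha> + s) * B x y"
    using assms by (simp add: sum_V_ops sum_nbrs_B ant_in B_ant algebra_simps)
  finally show ?thesis .
qed

text \<open>
  The matrix \<open>F = (I + P) (\<tau> I - A) + \<eta> J\<close>, with \<open>J\<close> the all-one matrix, is the analogue of \<open>B\<close> for the
  smallest eigenvalue \<open>-s^2\<close>. The constant \<open>\<eta>\<close> is chosen so that constant functions are mapped to zero.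
\<close>

definition \<eta> :: real where "\<eta> = (\<tau> + s) / (\<alpha> + s)"

definition F :: "'a \<Rightarrow> 'a \<Rightarrow> real" where "F x y = \<tau> * id_even x y - adj_even x y + \<eta>"

lemma F_sym: "x \<in> V \<Longrightarrow> y \<in> V \<Longrightarrow> F x y = F y x"
  by (simp add: F_def op_sym)

lemma F_ant: "x \<in> V \<Longrightarrow> y \<in> V \<Longrightarrow> F (ant x) y = F x y"
  by (simp_all add: F_def common_ant_arg)

lemma card_nbrs': "x \<in> V \<Longrightarrow> card (nbrs x) = k"
  using card_nbrs by (simp add: nbrs_def)

lemma eta: "real k * \<eta> - 2 * m = - s\<^sup>2 * \<eta>"
proof -
  have "(real k + s\<^sup>2) * \<eta> = s * ((\<alpha> + s) * \<eta>)"
    unfolding alpha by (simp add: algebra_simps power2_eq_square)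
  also have "(\<alpha> + s) * \<eta> = \<tau> + s"
    using alpha(3) s_gt by (simp add: \<eta>_def)
  finally show ?thesis using m_eq by (simp add: algebra_simps)
qed

lemma sum_nbrs_F:
  assumes "x \<in> V" "y \<in> V"
  shows "(\<Sum>i\<in>nbrs x. F i y) = - s\<^sup>2 * F x y"
proof -
  have "(\<Sum>i\<in>nbrs x. F i y) = \<tau> * adj_even x y - (k * id_even x y + l * adj_even x y + 2 * m * (1 - id_even x y - adj_even x y)) + k * \<eta>"
    using sum_nbrs_id_even[OF assms] sum_nbrs_adj_even[OF assms] card_nbrs'[OF assms(1)]
    by (simp add: F_def sum.distrib sum_distrib_left[symmetric] sum_subtractf)
  also have "\<dots> = (\<tau> - real l + 2 * real m) * adj_even x y + (2 * real m - real k) * id_even x y + (k * \<eta> - 2 * m)"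
    by (simp add: algebra_simps)
  also have "\<tau> - real l + 2 * real m = s\<^sup>2" unfolding l_eq m_eq by (simp add: algebra_simps power2_eq_square)
  also have "2 * real m - real k = - s\<^sup>2 * \<tau>"
    unfolding k_eq m_eq by (simp add: algebra_simps power2_eq_square)
  finally show ?thesis using eta by (simp add: F_def algebra_simps)
qed

lemma sum_V_F:
  assumes "y \<in> V"
  shows "(\<Sum>i\<in>V. F i y) = 0"
proof -
  have "k * (\<Sum>i\<in>V. F i y) = - s\<^sup>2 * (\<Sum>i\<in>V. F i y)"
    using sum_V_nbrs[of "\<lambda>i. F i y"] sum_nbrs_F assms by (simp add: sum_distrib_left)
  hence "(k + s\<^sup>2) * (\<Sum>i\<in>V. F i y) = 0" by (simp add: algebra_simps)
  moreover have "real k + s\<^sup>2 > 0" using s_gt by (simp add: add_nonneg_pos)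
  ultimately show ?thesis by auto
qed

lemma F_F:
  assumes "x \<in> V" "y \<in> V"
  shows "(\<Sum>i\<in>V. F x i * F i y) = 2 * (\<tau> + s\<^sup>2) * F x y"
proof -
  have "(\<Sum>i\<in>V. F x i * F i y) = \<tau> * (\<Sum>i\<in>V. id_even x i * F i y) - (\<Sum>i\<in>V. adj_even x i * F i y) + \<eta> * (\<Sum>i\<in>V. F i y)"
    unfolding F_def[of x] by (simp add: algebra_simps sum.distrib sum_distrib_left sum_subtractf)
  also have "\<dots> = 2 * (\<tau> + s\<^sup>2) * F x y"
    using assms by (simp add: sum_V_ops sum_nbrs_F ant_in F_ant sum_V_F algebra_simps)
  finally show ?thesis .
qed

lemma card_local: "adj x y \<Longrightarrow> card (nbrs x \<inter> nbrs y) = l"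
  using card_common_adj by (simp add: nbrs_def Collect_conj_eq)

lemma local_values:
  assumes "adj x y" "adj x z"
  shows "B y z = s * of_bool (y = z) + of_bool (adj y z)"
    "F y z = \<tau> * of_bool (y = z) - of_bool (adj y z) + \<eta>"
proof -
  have "ant y \<noteq> z" "\<not> adj (ant y) z"
    using assms adj_in2 adj_sym no_common_ant[of y x] no_common_three[of y z x] by auto
  thus "B y z = s * of_bool (y = z) + of_bool (adj y z)"
    "F y z = \<tau> * of_bool (y = z) - of_bool (adj y z) + \<eta>"
    by (simp_all add: B_def F_def id_odd_def adj_odd_def id_even_def adj_even_def)
qed

lemma B_adj: "adj x y \<Longrightarrow> B x y = 1"
  using adj_irrefl no_common_ant[of x y] not_adj_ant[of x] adj_in
  by (auto simp: B_def id_odd_def adj_odd_def)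

lemma B_self: "x \<in> V \<Longrightarrow> B x x = s"
  using adj_irrefl ant_neq not_adj_ant adj_commute by (auto simp: B_def id_odd_def adj_odd_def)

lemma sum_of_bool_eq: "finite N \<Longrightarrow> y \<in> N \<Longrightarrow> (\<Sum>z\<in>N. of_bool (y = z) * f z) = (f y :: real)"
  by (simp add: of_bool_def if_distrib[of "\<lambda>t. t * _"] cong: if_cong)

lemma sum_of_bool_adj: "finite N \<Longrightarrow> (\<Sum>z\<in>N. of_bool (adj y z) * f z) = (\<Sum>z\<in>N \<inter> nbrs y. f z :: real)"
  by (simp add: of_bool_def if_distrib[of "\<lambda>t. t * _"] sum.If_cases nbrs_def cong: if_cong)

lemma sum_of_bool_adj_1: "finite N \<Longrightarrow> (\<Sum>z\<in>N. of_bool (adj y z)) = real (card (N \<inter> nbrs y))"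
  using sum_of_bool_adj[of N y "\<lambda>_. 1"] by simp

lemma sum_local_F:
  assumes "adj x y" "M \<subseteq> nbrs x"
  shows "(\<Sum>z\<in>M. F y z) = \<tau> * of_bool (y \<in> M) - real (card (M \<inter> nbrs y)) + \<eta> * real (card M)"
proof -
  have f: "finite M" using assms finite_subset finite_nbrs by blast
  have "(\<Sum>z\<in>M. F y z) = (\<Sum>z\<in>M. \<tau> * of_bool (y = z) - of_bool (adj y z) * 1 + \<eta>)"
    using assms local_values[of x y] by (intro sum.cong refl) auto
  also have "\<dots> = \<tau> * (\<Sum>z\<in>M. of_bool (y = z)) - (\<Sum>z\<in>M. of_bool (adj y z) * 1) + \<eta> * real (card M)"
    by (simp only: sum.distrib sum_subtractf sum_distrib_left[symmetric]) simp
  also have "(\<Sum>z\<in>M. of_bool (y = z)) = (of_bool (y \<in> M) :: real)"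
    using f by (simp add: of_bool_def)
  finally show ?thesis unfolding sum_of_bool_adj[OF f] by simp
qed

text \<open>
  On the neighbourhood of \<open>x\<close>, with local adjacency matrix \<open>N\<close>, the rows of \<open>B\<close> projected away from \<open>x\<close> have the
  Gram matrix \<open>N + s I - J / s\<close> and the rows of \<open>F\<close> have the Gram matrix \<open>\<tau> I - N + \<eta> J\<close>, up to factors. By
  themselves these bound the nontrivial local eigenvalues by \<open>-s\<close> and \<open>\<tau>\<close>. The trace of their product is zero
  because \<open>l = \<tau> (s + 1)\<close>, so both bounds are attained and the product itself is zero.
\<close>

lemma local_orthogonal:
  assumes x: "x \<in> V" and i: "i \<in> V" and j: "j \<in> V"
  shows "(\<Sum>y\<in>nbrs x. (B i y - B i x / s) * F j y) = 0"
proof -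
  define \<kappa> where "\<kappa> = 2 * (\<alpha> + s)"
  define \<kappa>' where "\<kappa>' = 2 * (\<tau> + s\<^sup>2)"
  define u where "u i y = B i y - B i x / s" for i y
  have uu: "(\<Sum>i\<in>V. u i y * u i z) = \<kappa> * (B y z - 1 / s)" if "adj x y" "adj x z" for y z
  proof -
    have in_V: "y \<in> V" "z \<in> V" using that adj_in2 by auto
    have bb: "(\<Sum>i\<in>V. B i a * B i b) = \<kappa> * B a b" if "a \<in> V" "b \<in> V" for a b
    proof -
      have "(\<Sum>i\<in>V. B i a * B i b) = (\<Sum>i\<in>V. B a i * B i b)"
        using that B_sym by (intro sum.cong refl) simp
      thus ?thesis using B_B that by (simp add: \<kappa>_def)
    qed
    have "(\<Sum>i\<in>V. u i y * u i z) = (\<Sum>i\<in>V. B i y * B i z) - (\<Sum>i\<in>V. B i y * B i x) / s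
       - (\<Sum>i\<in>V. B i x * B i z) / s + (\<Sum>i\<in>V. B i x * B i x) / s\<^sup>2"
      unfolding u_def by (simp add: algebra_simps sum.distrib sum_subtractf sum_divide_distrib power2_eq_square)
    also have "\<dots> = \<kappa> * B y z - \<kappa> * 1 / s - \<kappa> * 1 / s + \<kappa> * s / s\<^sup>2"
      using bb in_V x B_adj[of x] B_adj[of y x] B_self that adj_sym by simp
    also have "\<dots> = \<kappa> * (B y z - 1 / s)"
      using s_gt by (simp add: power2_eq_square right_diff_distrib)
    finally show ?thesis .
  qed
  have ff: "(\<Sum>j\<in>V. F j y * F j z) = \<kappa>' * F y z" if "adj x y" "adj x z" for y z
  proof -
    have in_V: "y \<in> V" "z \<in> V" using that adj_in2 by auto
    have "(\<Sum>i\<in>V. F i y * F i z) = (\<Sum>i\<in>V. F y i * F i z)"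
      using in_V F_sym by (intro sum.cong refl) simp
    thus ?thesis using F_F in_V by (simp add: \<kappa>'_def)
  qed
  \<comment> \<open>the diagonal entries of the product of the two Gram matrices vanish, and with them its trace\<close>
  have inner: "(\<Sum>z\<in>nbrs x. (B y z - 1 / s) * F y z) = 0" if y: "adj x y" for y
  proof -
    have "(\<Sum>z\<in>nbrs x. (B y z - 1 / s) * F y z) =
      (\<Sum>z\<in>nbrs x. s * (of_bool (y = z) * F y z) + of_bool (adj y z) * F y z - 1 / s * F y z)"
      using y local_values[of x y] by (intro sum.cong refl) (simp add: algebra_simps)
    also have "\<dots> = s * F y y + (\<Sum>z\<in>nbrs x \<inter> nbrs y. F y z) - 1 / s * (\<Sum>z\<in>nbrs x. F y z)"
      using y by (simp only: sum.distrib sum_subtractf sum_distrib_left[symmetric]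
          sum_of_bool_eq sum_of_bool_adj finite_nbrs in_nbrs)
    also have "\<dots> = s * (\<tau> + \<eta>) + (- real l + \<eta> * real l) - 1 / s * (\<tau> - real l + \<eta> * real k)"
      using sum_local_F[OF y, of "nbrs x"] sum_local_F[OF y, of "nbrs x \<inter> nbrs y"] y
        card_local[OF y] card_nbrs'[OF x] local_values(2)[OF y y] adj_irrefl
      by (simp add: Int_assoc)
    also have "\<dots> = \<eta> * (s + real l - real k / s) + (s * s * \<tau> - s * real l - \<tau> + real l) / s"
      using s_gt by (simp add: field_simps)
    also have "s + real l - real k / s = 0" using s_gt by (simp add: alpha)
    also have "s * s * \<tau> - s * real l - \<tau> + real l = 0"
      by (simp add: l_eq algebra_simps)
    finally show ?thesis by simp
  qed
  have "(\<Sum>i\<in>V. \<Sum>j\<in>V. (\<Sum>y\<in>nbrs x. u i y * F j y)\<^sup>2) =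
      (\<Sum>y\<in>nbrs x. \<Sum>z\<in>nbrs x. (\<kappa> * (B y z - 1 / s)) * (\<kappa>' * F y z))"
    unfolding sum_of_squares_Gram using uu ff by (intro sum.cong refl) simp
  also have "\<dots> = \<kappa> * \<kappa>' * (\<Sum>y\<in>nbrs x. \<Sum>z\<in>nbrs x. (B y z - 1 / s) * F y z)"
    by (simp add: sum_distrib_left mult_ac)
  also have "\<dots> = 0" using inner by simp
  finally show ?thesis using sum_squares_zero[OF finite_V finite_V _ i j, of "\<lambda>i j. \<Sum>y\<in>nbrs x. u i y * F j y"]
    unfolding u_def by simp
qed

text \<open>
  The entries of \<open>(N + s I - J / s) (\<tau> I - N + \<eta> J) = 0\<close>: the local graph is strongly regular.
\<close>

lemma local_srg:
  assumes y: "adj x y" and z: "adj x z"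
  shows "real (card (nbrs x \<inter> nbrs y \<inter> nbrs z)) = s * \<tau> * of_bool (y = z) + (\<tau> - s) * of_bool (adj y z) + \<tau>"
proof -
  have in_V: "x \<in> V" "y \<in> V" "z \<in> V" using y z adj_in adj_in2 by auto
  have "0 = (\<Sum>w\<in>nbrs x. (B y w - B y x / s) * F z w)"
    using local_orthogonal in_V by simp
  also have "\<dots> = (\<Sum>w\<in>nbrs x. s * (of_bool (y = w) * F z w) + of_bool (adj y w) * F z w - 1 / s * F z w)"
    using y local_values(1)[of x y] B_adj[OF adj_sym[OF y]] by (intro sum.cong refl) (simp add: algebra_simps)
  also have "\<dots> = s * F z y + (\<Sum>w\<in>nbrs x \<inter> nbrs y. F z w) - 1 / s * (\<Sum>w\<in>nbrs x. F z w)"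
    using y by (simp only: sum.distrib sum_subtractf sum_distrib_left[symmetric]
        sum_of_bool_eq sum_of_bool_adj finite_nbrs in_nbrs)
  also have "\<dots> = s * (\<tau> * of_bool (y = z) - of_bool (adj y z) + \<eta>) +
      (\<tau> * of_bool (adj y z) - real (card (nbrs x \<inter> nbrs y \<inter> nbrs z)) + \<eta> * real l)
      - 1 / s * (\<tau> - real l + \<eta> * real k)"
    using sum_local_F[OF z, of "nbrs x"] sum_local_F[OF z, of "nbrs x \<inter> nbrs y"] y z
      card_local[OF y] card_local[OF z] card_nbrs'[OF in_V(1)] local_values(2)[OF z y] adj_commute[of z y]
    by (auto simp: Int_assoc)
  also have "\<dots> = s * \<tau> * of_bool (y = z) + (\<tau> - s) * of_bool (adj y z)
     - real (card (nbrs x \<inter> nbrs y \<inter> nbrs z)) + \<eta> * (s + real l - real k / s) + (real l - \<tau>) / s"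
    using s_gt by (simp add: field_simps)
  also have "s + real l - real k / s = 0" using s_gt by (simp add: alpha)
  also have "(real l - \<tau>) / s = \<tau>" using s_gt by (simp add: l_eq field_simps)
  finally show ?thesis by simp
qed

text \<open>
  An eigenvalue other than the valency \<open>l\<close> has an eigenfunction with sum zero, on which \<open>local_srg\<close> becomes a
  quadratic equation.
\<close>

lemma local_eigenvalue:
  fixes f :: "'a \<Rightarrow> real" and t :: real
  assumes "x \<in> V" and ev: "\<And>y. adj x y \<Longrightarrow> (\<Sum>z\<in>nbrs x \<inter> nbrs y. f z) = t * f y"
    and y: "adj x y0" "f y0 \<noteq> 0" and t: "t \<noteq> real l"
  shows "t = \<tau> \<or> t = - s"
proof -
  have swap: "(\<Sum>y\<in>M. \<Sum>z\<in>nbrs x \<inter> nbrs y. f z) = (\<Sum>z\<in>nbrs x. real (card (M \<inter> nbrs z)) * f z)"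
    if M: "M \<subseteq> nbrs x" for M
  proof -
    have fM: "finite M" using M finite_subset finite_nbrs by blast
    have "(\<Sum>y\<in>M. \<Sum>z\<in>nbrs x \<inter> nbrs y. f z) = (\<Sum>y\<in>M. \<Sum>z\<in>nbrs x. of_bool (adj y z) * f z)"
      by (simp only: sum_of_bool_adj[OF finite_nbrs])
    also have "\<dots> = (\<Sum>z\<in>nbrs x. (\<Sum>y\<in>M. of_bool (adj z y) * 1) * f z)"
      by (subst sum.swap) (simp add: sum_distrib_right adj_commute)
    finally show ?thesis unfolding sum_of_bool_adj[OF fM] by simp
  qed
  have "t * sum f (nbrs x) = real l * sum f (nbrs x)"
    using swap[of "nbrs x"] ev card_local by (simp add: sum_distrib_left)
  hence z: "sum f (nbrs x) = 0" using t by simp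
  have "t * (t * f y0) = (\<Sum>y\<in>nbrs x \<inter> nbrs y0. \<Sum>z\<in>nbrs x \<inter> nbrs y. f z)"
    using ev[symmetric] by (simp only: ev[OF y(1), symmetric] sum_distrib_left) (intro sum.cong, auto simp: ev)
  also have "\<dots> = (\<Sum>z\<in>nbrs x. real (card (nbrs x \<inter> nbrs y0 \<inter> nbrs z)) * f z)"
    by (rule swap) auto
  also have "\<dots> = (\<Sum>z\<in>nbrs x. s * \<tau> * (of_bool (y0 = z) * f z) + (\<tau> - s) * (of_bool (adj y0 z) * f z) + \<tau> * f z)"
  proof (intro sum.cong refl)
    fix z assume "z \<in> nbrs x"
    thus "real (card (nbrs x \<inter> nbrs y0 \<inter> nbrs z)) * f z =
        s * \<tau> * (of_bool (y0 = z) * f z) + (\<tau> - s) * (of_bool (adj y0 z) * f z) + \<tau> * f z"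
      by (simp only: local_srg[OF y(1)] in_nbrs distrib_right mult.assoc)
  qed
  also have "\<dots> = s * \<tau> * f y0 + (\<tau> - s) * (t * f y0)"
    using y ev[OF y(1)] z by (simp only: sum.distrib sum_distrib_left[symmetric]
        sum_of_bool_eq sum_of_bool_adj finite_nbrs in_nbrs)
  finally have "(t - \<tau>) * (t + s) * f y0 = 0" by (simp add: algebra_simps)
  thus ?thesis using y by auto
qed

end

section \<open>Common neighbours of two and of three vertices\<close>

context antipodal_double_cover
begin

text \<open>
  The handshake lemma for the subgraph induced on \<open>D\<close>.
\<close>

lemma even_sum_degrees:
  assumes "finite D"
  shows "even (\<Sum>y\<in>D. card (D \<inter> nbrs y))"
  using assms
proof induction
  case (insert a D)
  have "card (insert a D \<inter> nbrs y) = of_bool (adj a y) + card (D \<inter> nbrs y)" for y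
    using insert by (auto simp: adj_commute)
  hence "(\<Sum>y\<in>insert a D. card (insert a D \<inter> nbrs y)) =
     card (D \<inter> nbrs a) + (\<Sum>y\<in>D. of_bool (adj a y)) + (\<Sum>y\<in>D. card (D \<inter> nbrs y))"
    using insert by (simp add: sum.distrib adj_irrefl)
  also have "(\<Sum>y\<in>D. of_bool (adj a y)) = card (D \<inter> nbrs a)"
    using insert by (simp add: of_bool_def sum.If_cases nbrs_def)
  finally show ?case using insert.IH by simp
qed simp

lemma sum_adj_even:
  assumes "finite M"
  shows "(\<Sum>y\<in>M. adj_even z y) = real (card (M \<inter> nbrs z)) + real (card (M \<inter> nbrs (ant z)))"
  using assms by (simp add: adj_even_def sum.distrib of_bool_def sum.If_cases nbrs_def)

lemma dist2_vals:
  assumes "dist2 x z"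
  shows "id_even x z = 0" "adj_even x z = 0" "id_odd x z = 0" "adj_odd x z = 0"
  using assms by (auto simp: dist2_def id_even_def adj_even_def id_odd_def adj_odd_def)

lemma adj_even_adj: "adj x y \<Longrightarrow> adj_even x y = 1" "adj x y \<Longrightarrow> id_even x y = 0"
  using no_common_ant[of x y] adj_in[of x y] adj_irrefl not_adj_ant[of x] by (auto simp: adj_even_def id_even_def)

lemma adj_even_self: "x \<in> V \<Longrightarrow> adj_even x x = 0" "x \<in> V \<Longrightarrow> id_even x x = 1"
  using adj_irrefl not_adj_ant[of x] ant_neq by (auto simp: adj_even_def id_even_def adj_commute)

lemma adj_even_idem: "x \<in> V \<Longrightarrow> adj_even x y * adj_even x y = adj_even x y"
  using no_common_ant[of x y] by (auto simp: adj_even_def)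

end

context tight_double_cover
begin

text \<open>
  Seen from \<open>y\<close>, the vertices \<open>x\<close> and \<open>z\<close> are nonadjacent vertices of the local graph at \<open>y\<close>.
\<close>

lemma mu_graph_valency:
  assumes "dist2 x z" "adj y x" "adj y z"
  shows "real (card (nbrs x \<inter> nbrs z \<inter> nbrs y)) = \<tau>"
proof -
  have "nbrs y \<inter> nbrs x \<inter> nbrs z = nbrs x \<inter> nbrs z \<inter> nbrs y" by auto
  thus ?thesis using local_srg[OF assms(2,3)] assms(1) by (auto simp: dist2_def)
qed

lemma mu_graph_parity:
  assumes "dist2 x z" "\<tau> = real n"
  shows "even (m * n)"
proof -
  have "card (nbrs x \<inter> nbrs z \<inter> nbrs y) = n" if "y \<in> nbrs x \<inter> nbrs z" for y
    using mu_graph_valency[OF assms(1), of y] that adj_sym assms(2) by auto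
  hence "(\<Sum>y\<in>nbrs x \<inter> nbrs z. card (nbrs x \<inter> nbrs z \<inter> nbrs y)) = m * n"
    using dist2_common[OF assms(1)] by simp
  thus ?thesis using even_sum_degrees[of "nbrs x \<inter> nbrs z"] by (metis finite_Int finite_nbrs)
qed

text \<open>
  In the local graph at \<open>y\<close> two nonadjacent vertices together with all their neighbours make up \<open>2 + 2 l - \<tau>\<close>
  vertices, which is less than \<open>k\<close>. So a third vertex can be found, and nonadjacent neighbours of \<open>y\<close> are at distance 2.
\<close>

lemma obtain_local_coclique:
  assumes "y \<in> V" and s2: "s \<ge> 2"
  obtains x z w where "dist2 x z" "dist2 x w" "dist2 z w"
proof -
  have pos: "\<tau> * (s * s) \<ge> \<tau> * (2 * s)" "s * s \<ge> 2 * s" "\<tau> * s \<ge> \<tau> * 2"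
    using s2 tau_ge by (auto intro!: mult_left_mono mult_right_mono)
  have "real k > 0" using alpha s_gt by simp
  hence "card (nbrs y) > 0" using card_nbrs'[OF assms(1)] by simp
  then obtain x where x: "adj y x" using card_gt_0_iff[of "nbrs y"] by auto
  have "real (card (insert x (nbrs y \<inter> nbrs x))) \<le> 1 + real l"
    using card_local[OF x] by (simp add: adj_irrefl)
  also have "1 + real l < real k"
  proof -
    have "1 + real l = 1 + \<tau> * s + \<tau>" "real k = \<tau> * (s * s) + \<tau> * s + s * s"
      by (simp_all add: l_eq k_eq algebra_simps)
    moreover have "\<tau> * (2 * s) = 2 * (\<tau> * s)" by simp
    ultimately show ?thesis using pos s2 tau_ge by linarith
  qed
  finally have "\<not> nbrs y \<subseteq> insert x (nbrs y \<inter> nbrs x)"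
    using card_mono[of "insert x (nbrs y \<inter> nbrs x)" "nbrs y"] card_nbrs'[OF assms(1)] by auto
  then obtain z where "z \<in> nbrs y" "z \<notin> insert x (nbrs y \<inter> nbrs x)" by blast
  hence z: "adj y z" "z \<noteq> x" "\<not> adj x z" by auto
  have xz: "dist2 x z" using adj_adj_dist2[OF x z(1)] z by auto
  let ?M = "insert x (insert z ((nbrs y \<inter> nbrs x) \<union> (nbrs y \<inter> nbrs z)))"
  have "real (card ((nbrs y \<inter> nbrs x) \<union> (nbrs y \<inter> nbrs z))) + \<tau> = 2 * real l"
  proof -
    have "(nbrs y \<inter> nbrs x) \<inter> (nbrs y \<inter> nbrs z) = nbrs x \<inter> nbrs z \<inter> nbrs y" by auto
    thus ?thesis using card_Un_Int[of "nbrs y \<inter> nbrs x" "nbrs y \<inter> nbrs z"]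
      card_local[OF x] card_local[OF z(1)] mu_graph_valency[OF xz x z(1)] by simp
  qed
  moreover have "card ?M \<le> 2 + card ((nbrs y \<inter> nbrs x) \<union> (nbrs y \<inter> nbrs z))"
    by (simp add: card_insert_if)
  ultimately have "real (card ?M) \<le> 2 + 2 * real l - \<tau>" by linarith
  also have "\<dots> < real k"
  proof -
    have "2 * real l = 2 * (\<tau> * s) + 2 * \<tau>" "real k = \<tau> * (s * s) + \<tau> * s + s * s"
      by (simp_all add: l_eq k_eq algebra_simps)
    moreover have "\<tau> * (2 * s) = 2 * (\<tau> * s)" by simp
    ultimately show ?thesis using pos s2 tau_ge by linarith
  qed
  finally have "\<not> nbrs y \<subseteq> ?M"
    using card_mono[of ?M "nbrs y"] card_nbrs'[OF assms(1)] by auto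
  then obtain w where "w \<in> nbrs y" "w \<notin> ?M" by blast
  hence w: "adj y w" "w \<noteq> x" "w \<noteq> z" "\<not> adj x w" "\<not> adj z w" by auto
  have "dist2 x w" "dist2 z w" using adj_adj_dist2[OF x w(1)] adj_adj_dist2[OF z(1) w(1)] w by auto
  thus ?thesis using that xz by blast
qed

lemma B_columns:
  assumes "a \<in> V" "b \<in> V"
  shows "(\<Sum>i\<in>V. B i a * B i b) = 2 * (\<alpha> + s) * B a b"
proof -
  have "(\<Sum>i\<in>V. B i a * B i b) = (\<Sum>i\<in>V. B a i * B i b)"
    using assms B_sym by (intro sum.cong refl) simp
  thus ?thesis using B_B assms by simp
qed

lemma B_dist2: "dist2 x z \<Longrightarrow> B x z = 0"
  by (simp add: B_def dist2_vals)

text \<open>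
  Scale the rows of \<open>B\<close> so that \<open>B\<close> is their Gram matrix. Then \<open>x\<close> and \<open>z\<close> are orthogonal of squared norm \<open>s\<close>, and the common neighbours have inner product 1 with
  both, so \<open>m / s (x + z)\<close> is the projection of their sum to the plane of \<open>x\<close> and \<open>z\<close>. The squared norms are
  \<open>m (s + \<tau>)\<close> for the sum and \<open>2 m^2 / s\<close> for the projection. They agree since \<open>2 m = s (\<tau> + s)\<close>.
\<close>

lemma sum_common_nbrs:
  assumes xz: "dist2 x z" and i: "i \<in> V"
  shows "(\<Sum>y\<in>nbrs x \<inter> nbrs z. B i y) = m / s * (B i x + B i z)"
proof -
  let ?D = "nbrs x \<inter> nbrs z"
  define \<kappa> where "\<kappa> = 2 * (\<alpha> + s)"
  define c where "c = m / s"
  define S where "S i = (\<Sum>y\<in>?D. B i y)" for i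
  define P where "P i = B i x + B i z" for i
  have in_V: "x \<in> V" "z \<in> V" using xz by (auto simp: dist2_def)
  have DV: "y \<in> V" if "y \<in> ?D" for y using that adj_in2 by auto
  have row: "(\<Sum>y'\<in>?D. B y y') = s + \<tau>" if y: "y \<in> ?D" for y
  proof -
    have "(\<Sum>y'\<in>?D. B y y') = (\<Sum>y'\<in>?D. s * (of_bool (y = y') * 1) + of_bool (adj y y') * 1)"
      using y local_values[of x y] by (intro sum.cong refl) auto
    also have "\<dots> = s + real (card (?D \<inter> nbrs y))"
      using y by (simp only: sum.distrib sum_distrib_left[symmetric]
        sum_of_bool_eq sum_of_bool_adj finite_nbrs finite_Int) (simp add: nbrs_def[symmetric])
    finally show ?thesis using mu_graph_valency[OF xz, of y] y adj_sym by auto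
  qed
  have SS: "(\<Sum>i\<in>V. S i * S i) = \<kappa> * (m * (s + \<tau>))"
  proof -
    have "(\<Sum>i\<in>V. S i * S i) = (\<Sum>i\<in>V. \<Sum>y\<in>?D. \<Sum>y'\<in>?D. B i y * B i y')"
      by (simp add: S_def sum_product)
    also have "\<dots> = (\<Sum>y\<in>?D. \<Sum>i\<in>V. \<Sum>y'\<in>?D. B i y * B i y')" by (rule sum.swap)
    also have "\<dots> = (\<Sum>y\<in>?D. \<Sum>y'\<in>?D. \<Sum>i\<in>V. B i y * B i y')"
      by (intro sum.cong refl sum.swap)
    also have "\<dots> = (\<Sum>y\<in>?D. \<Sum>y'\<in>?D. \<kappa> * B y y')"
      using B_columns DV by (intro sum.cong refl) (simp add: \<kappa>_def)
    also have "\<dots> = (\<Sum>y\<in>?D. \<kappa> * (s + \<tau>))"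
      using row by (intro sum.cong refl) (simp add: sum_distrib_left[symmetric])
    finally show ?thesis using dist2_common[OF xz] by simp
  qed
  have SP: "(\<Sum>i\<in>V. S i * P i) = \<kappa> * (2 * m)"
  proof -
    have "(\<Sum>i\<in>V. S i * P i) = (\<Sum>y\<in>?D. \<Sum>i\<in>V. B i y * P i)"
      by (subst sum.swap) (simp add: S_def sum_distrib_right)
    also have "\<dots> = (\<Sum>y\<in>?D. \<kappa> * 2)"
    proof (intro sum.cong refl)
      fix y assume y: "y \<in> ?D"
      have "(\<Sum>i\<in>V. B i y * P i) = \<kappa> * B y x + \<kappa> * B y z"
        using B_columns[OF DV[OF y]] in_V by (simp add: P_def \<kappa>_def distrib_left sum.distrib)
      thus "(\<Sum>i\<in>V. B i y * P i) = \<kappa> * 2" using B_adj y adj_sym by simp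
    qed
    finally show ?thesis using dist2_common[OF xz] by simp
  qed
  have PP: "(\<Sum>i\<in>V. P i * P i) = \<kappa> * (2 * s)"
  proof -
    have "(\<Sum>i\<in>V. P i * P i) = (\<Sum>i\<in>V. B i x * B i x) + 2 * (\<Sum>i\<in>V. B i x * B i z) + (\<Sum>i\<in>V. B i z * B i z)"
      by (simp add: P_def algebra_simps sum.distrib sum_distrib_left)
    thus ?thesis using B_columns in_V B_dist2[OF xz] B_self by (simp add: \<kappa>_def)
  qed
  have "(\<Sum>i\<in>V. (S i - c * P i)\<^sup>2) = (\<Sum>i\<in>V. S i * S i) - 2 * c * (\<Sum>i\<in>V. S i * P i) + c * c * (\<Sum>i\<in>V. P i * P i)"
    by (simp add: power2_eq_square algebra_simps sum.distrib sum_subtractf sum_distrib_left)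
  also have "\<dots> = \<kappa> * m * (s + \<tau> - 2 * m / s)"
    using s_gt unfolding SS SP PP c_def by (simp add: field_simps)
  also have "\<dots> = 0" using s_gt by (simp add: m_eq)
  finally have "\<forall>i\<in>V. (S i - c * P i)\<^sup>2 = 0"
    using sum_nonneg_eq_0_iff[of V "\<lambda>i. (S i - c * P i)\<^sup>2"] finite_V by auto
  thus ?thesis using i by (simp add: S_def P_def c_def)
qed

text \<open>
  The vector of \<open>w\<close> is orthogonal to \<open>x\<close> and \<open>z\<close>, hence to the sum of their common neighbours.
\<close>

lemma common_three_ant:
  assumes xz: "dist2 x z" and xw: "dist2 x w"
  and zw: "dist2 z w"
  shows "card (nbrs x \<inter> nbrs z \<inter> nbrs (ant w)) = card (nbrs x \<inter> nbrs z \<inter> nbrs w)"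
proof -
  let ?D = "nbrs x \<inter> nbrs z"
  have "(\<Sum>y\<in>?D. B w y) = 0"
    using sum_common_nbrs[OF xz, of w] B_dist2[OF dist2_sym[OF xw]] B_dist2[OF dist2_sym[OF zw]] xw
    by (simp add: dist2_def)
  moreover have "B w y = of_bool (adj w y) - of_bool (adj (ant w) y)" if "y \<in> ?D" for y
  proof -
    have "w \<noteq> y" "ant w \<noteq> y" using that xw dist2_ant[OF xw] by (auto simp: dist2_def)
    thus ?thesis by (simp add: B_def id_odd_def adj_odd_def)
  qed
  ultimately have "(\<Sum>y\<in>?D. of_bool (adj w y) - of_bool (adj (ant w) y) :: real) = 0"
    by simp
  moreover have "finite ?D" by simp
  ultimately show ?thesis by (simp only: sum_subtractf sum_of_bool_adj_1)
qed

text \<open>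
  The left-hand side counts the neighbours of \<open>x\<close> that are adjacent to \<open>z\<close> or \<open>ant z\<close> and to \<open>w\<close> or \<open>ant w\<close>. By
  \<open>common_three_ant\<close> the four choices contribute equally.
\<close>

lemma sum_adj_even_adj_even:
  assumes xz: "dist2 x z" and xw: "dist2 x w" and zw: "dist2 z w"
  shows "(\<Sum>y\<in>nbrs x. adj_even z y * adj_even w y) = 4 * real (card (nbrs x \<inter> nbrs z \<inter> nbrs w))"
proof -
  define e where "e z w = (\<Sum>y\<in>nbrs x. of_bool (adj z y) * of_bool (adj w y) :: real)" for z w
  have e: "e z w = real (card (nbrs x \<inter> nbrs z \<inter> nbrs w))" for z w
    unfolding e_def sum_of_bool_adj[OF finite_nbrs] by (simp add: nbrs_def[symmetric])
  have comm: "e z w = e w z" for z w by (simp add: e_def mult.commute)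
  have flip: "e z (ant w) = e z w" if "dist2 x z" "dist2 x w" "dist2 z w" for z w
    using common_three_ant[OF that] by (simp add: e)
  have zw': "dist2 (ant z) w" using dist2_ant dist2_sym zw by blast
  have "(\<Sum>y\<in>nbrs x. adj_even z y * adj_even w y) = e z w + e z (ant w) + e (ant z) w + e (ant z) (ant w)"
    by (simp add: e_def adj_even_def algebra_simps sum.distrib)
  also have "\<dots> = 4 * e z w"
  proof -
    have "e z (ant w) = e z w" by (rule flip[OF xz xw zw])
    moreover have "e (ant z) w = e z w"
      using flip[OF xw xz dist2_sym[OF zw]] by (simp only: comm[of "ant z" w] comm[of z w])
    moreover have "e (ant z) (ant w) = e (ant z) w" by (rule flip[OF dist2_ant[OF xz] xw zw'])
    ultimately show ?thesis by linarith
  qed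
  finally show ?thesis by (simp add: e)
qed

text \<open>
  These are the inner products of the tensor squares of the rows of \<open>B\<close>.
\<close>

lemma B_sq:
  assumes "x \<in> V"
  shows "B x y * B x y = s\<^sup>2 * id_even x y + adj_even x y"
proof -
  have "\<not> adj (ant x) x" using not_adj_ant[OF assms] adj_sym by blast
  hence "x = y \<Longrightarrow> ant x \<noteq> y \<and> \<not> adj x y \<and> \<not> adj (ant x) y"
    using ant_neq[OF assms] adj_irrefl by metis
  moreover have "ant x = y \<Longrightarrow> \<not> adj x y \<and> \<not> adj (ant x) y"
    using not_adj_ant[OF assms] adj_irrefl by metis
  moreover have "adj x y \<Longrightarrow> \<not> adj (ant x) y" by (rule no_common_ant[OF assms])
  ultimately show ?thesis
    by (cases "x = y"; cases "ant x = y"; cases "adj x y"; cases "adj (ant x) y")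
      (simp_all add: B_def id_odd_def adj_odd_def id_even_def adj_even_def power2_eq_square)
qed

lemma sum_adj_even_nbrs:
  assumes "dist2 x z"
  shows "(\<Sum>y\<in>nbrs x. adj_even z y) = 2 * real m"
  using sum_adj_even[of "nbrs x" z] dist2_common[OF assms] dist2_common[OF dist2_ant[OF assms]] by simp

text \<open>
  Up to a constant, the set of neighbours of \<open>x\<close> that are adjacent to \<open>z\<close> or \<open>ant z\<close> is an eigenvector of the local
  graph for \<open>-s\<close>: this expresses that the common neighbours of \<open>x\<close> with \<open>z\<close> and with \<open>ant z\<close> have a sum
  proportional to \<open>x\<close>.
\<close>

lemma local_adj_even_eigen:
  assumes xz: "dist2 x z" and y: "adj x y"
  shows "(\<Sum>w\<in>nbrs x \<inter> nbrs y. adj_even z w) = 2 * real m / s - s * adj_even z y"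
proof -
  have in_V: "x \<in> V" "z \<in> V" "y \<in> V" using xz y adj_in2 by (auto simp: dist2_def)
  have row: "s * of_bool (adj z y) + real (card (nbrs x \<inter> nbrs y \<inter> nbrs z)) = m / s * (1 + B y z)"
    if xz: "dist2 x z" for z
  proof -
    have "(\<Sum>w\<in>nbrs x \<inter> nbrs z. B y w) = (\<Sum>w\<in>nbrs x \<inter> nbrs z. s * of_bool (y = w) + of_bool (adj y w))"
      using y local_values[of x y] by (intro sum.cong refl) auto
    also have "\<dots> = s * of_bool (adj z y) + real (card (nbrs x \<inter> nbrs z \<inter> nbrs y))"
    proof -
      have f: "finite (nbrs x \<inter> nbrs z)" by simp
      have "(\<Sum>w\<in>nbrs x \<inter> nbrs z. of_bool (y = w)) = (of_bool (adj z y) :: real)"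
        using y by (simp add: of_bool_def)
      thus ?thesis unfolding sum.distrib sum_distrib_left[symmetric] sum_of_bool_adj_1[OF f] by simp
    qed
    also have "nbrs x \<inter> nbrs z \<inter> nbrs y = nbrs x \<inter> nbrs y \<inter> nbrs z" by auto
    finally show ?thesis using sum_common_nbrs[OF xz in_V(3)] B_adj[OF adj_sym[OF y]] by simp
  qed
  have "(\<Sum>w\<in>nbrs x \<inter> nbrs y. adj_even z w) + s * adj_even z y = m / s * (1 + B y z) + m / s * (1 + B y (ant z))"
    using row[OF xz] row[OF dist2_ant[OF xz]] by (simp add: sum_adj_even) (simp add: adj_even_def algebra_simps)
  also have "\<dots> = 2 * real m / s" using in_V by (simp add: B_ant algebra_simps)
  finally show ?thesis by simp
qed

text \<open>
  Under the first hypothesis the tensor square of \<open>z\<close> is a combination of those of \<open>x\<close> and its neighbours. By \<open>local_adj_even_eigen\<close> the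
  coefficient of a neighbour only depends on whether it is adjacent to the pair of \<open>z\<close>, and this leaves three unknown
  coefficients, given by the inner products with \<open>x\<close> and with the two kinds of neighbours. Cleared of denominators the
  solution is the vector \<open>v\<close> in the proof. The combination has norm zero exactly when \<open>\<tau> + s = s (s^2 - 1)\<close>. Its inner
  product with the tensor square of \<open>w\<close> is then a linear equation for the triple intersection number.
\<close>

lemma triple_intersection:
  assumes crit: "\<tau> + s = s * (s\<^sup>2 - 1)"
    and xz: "dist2 x z" and xw: "dist2 x w" and zw: "dist2 z w"
  shows "4 * real (card (nbrs x \<inter> nbrs z \<inter> nbrs w)) = s\<^sup>2 * (s - 1)"
proof -
  have in_V: "x \<in> V" "z \<in> V" "w \<in> V" using xz xw by (auto simp: dist2_def)
  define \<kappa> where "\<kappa> = 2 * (\<alpha> + s)"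
  define g where "g y = 1 - (s + 1) * adj_even z y" for y
  define v where "v y = s * (s\<^sup>2 - 1) * of_bool (z = y) + of_bool (adj x y) * g y + s * of_bool (x = y)" for y
  define K where "K y y' = s\<^sup>2 * id_even y y' + adj_even y y'" for y y'
  \<comment> \<open>up to a factor, the inner product of the combination \<open>v\<close> with the tensor square of \<open>y'\<close>\<close>
  define H where "H y' = (\<Sum>y\<in>V. v y * K y y')" for y'
  have K_sym: "K a b = K b a" if "a \<in> V" "b \<in> V" for a b
    using that op_sym by (simp add: K_def)
  have K_B: "B a b * B a b = K a b" if "a \<in> V" for a b
    using that B_sq by (simp add: K_def)
  have H: "H y' = s * (s\<^sup>2 - 1) * K z y' + (\<Sum>y\<in>nbrs x. g y * K y y') + s * K x y'" for y'
  proof -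
    have "H y' = s * (s\<^sup>2 - 1) * (\<Sum>y\<in>V. of_bool (z = y) * K y y')
      + (\<Sum>y\<in>V. of_bool (adj x y) * (g y * K y y')) + s * (\<Sum>y\<in>V. of_bool (x = y) * K y y')"
      unfolding H_def v_def by (simp add: distrib_right sum.distrib sum_distrib_left mult.assoc)
    thus ?thesis using in_V by (simp only: sum_V_point sum_V_adj)
  qed
  have m2: "2 * real m = s * (s * (s\<^sup>2 - 1))" using m_eq crit by simp
  have sum_g: "(\<Sum>y\<in>nbrs x. g y) = real k - (s + 1) * (2 * real m)"
    using sum_adj_even_nbrs[OF xz] card_nbrs'[OF in_V(1)]
    by (simp add: g_def sum_subtractf sum_distrib_left[symmetric])
  have Hx: "H x = 0"
  proof -
    have "K y x = 1" if "y \<in> nbrs x" for y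
      using that adj_even_adj[of y x] adj_sym by (simp add: K_def)
    hence "(\<Sum>y\<in>nbrs x. g y * K y x) = (\<Sum>y\<in>nbrs x. g y)" by (intro sum.cong) auto
    hence "H x = real k - (s + 1) * (2 * real m) + s ^ 3"
      unfolding H sum_g using dist2_vals[OF dist2_sym[OF xz]] adj_even_self[OF in_V(1)]
      by (simp add: K_def power2_eq_square power3_eq_cube)
    also have "\<dots> = 0" unfolding m_eq k_eq by (simp add: algebra_simps power3_eq_cube)
    finally show ?thesis .
  qed
  have Hz: "H z = 0"
  proof -
    have "g y * K y z = - s * adj_even z y" if "y \<in> nbrs x" for y
    proof -
      have "y \<in> V" using that adj_in2 by simp
      moreover have "z \<noteq> y" "ant z \<noteq> y" using that xz dist2_ant[OF xz] by (auto simp: dist2_def)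
      ultimately have "K y z = adj_even z y" using in_V K_sym[of y z] by (simp add: K_def id_even_def)
      thus ?thesis using adj_even_idem[OF in_V(2), of y] by (auto simp: g_def)
    qed
    hence "(\<Sum>y\<in>nbrs x. g y * K y z) = - s * (2 * real m)"
      using sum_adj_even_nbrs[OF xz] by (simp add: sum_negf sum_distrib_left[symmetric])
    hence "(\<Sum>y\<in>nbrs x. g y * K y z) = - s * (s * (s * (s\<^sup>2 - 1)))" by (simp only: m2)
    thus ?thesis unfolding H using dist2_vals[OF xz] adj_even_self[OF in_V(2)]
      by (simp add: K_def algebra_simps power2_eq_square)
  qed
  have Hy: "H y = 0" if y: "adj x y" for y
  proof -
    have yV: "y \<in> V" using y adj_in2 by simp
    have Kzy: "K z y = adj_even z y"
      using y xz dist2_ant[OF xz] by (auto simp: K_def id_even_def dist2_def)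
    have Kxy: "K x y = 1" using y by (simp add: K_def adj_even_adj)
    have "(\<Sum>a\<in>nbrs x. g a * K a y) = (\<Sum>a\<in>nbrs x. s\<^sup>2 * (of_bool (y = a) * g a) + of_bool (adj y a) * g a)"
    proof (intro sum.cong refl)
      fix a assume a: "a \<in> nbrs x"
      have "B y a = s * of_bool (y = a) + of_bool (adj y a)"
        using local_values(1)[OF y, of a] a by simp
      hence "K y a = s\<^sup>2 * of_bool (y = a) + of_bool (adj y a)"
        using K_B[OF yV, of a] by (auto simp: power2_eq_square adj_irrefl)
      thus "g a * K a y = s\<^sup>2 * (of_bool (y = a) * g a) + of_bool (adj y a) * g a"
        using a yV adj_in2 K_sym[of a y] by (simp add: algebra_simps)
    qed
    also have "\<dots> = s\<^sup>2 * g y + (\<Sum>a\<in>nbrs x \<inter> nbrs y. g a)"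
      using y by (simp only: sum.distrib sum_distrib_left[symmetric]
        sum_of_bool_eq sum_of_bool_adj finite_nbrs in_nbrs)
    also have "(\<Sum>a\<in>nbrs x \<inter> nbrs y. g a) = real l - (s + 1) * (2 * real m / s - s * adj_even z y)"
      using local_adj_even_eigen[OF xz y] card_local[OF y]
      by (simp add: g_def sum_subtractf sum_distrib_left[symmetric])
    also have "2 * real m / s = \<tau> + s" using s_gt by (simp add: m_eq)
    finally show ?thesis unfolding H Kzy Kxy
      by (simp add: g_def l_eq algebra_simps power2_eq_square)
  qed
  \<comment> \<open>the coordinates of the combination; it is zero because \<open>H\<close> vanishes wherever \<open>v\<close> does not\<close>
  define R where "R i j = (\<Sum>y\<in>V. (v y * B i y) * B j y)" for i j
  have "(\<Sum>i\<in>V. \<Sum>j\<in>V. (R i j)\<^sup>2) =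
      (\<Sum>y\<in>V. \<Sum>y'\<in>V. (\<Sum>i\<in>V. (v y * B i y) * (v y' * B i y')) * (\<Sum>j\<in>V. B j y * B j y'))"
    unfolding R_def by (rule sum_of_squares_Gram)
  also have "\<dots> = (\<Sum>y\<in>V. \<Sum>y'\<in>V. \<kappa>\<^sup>2 * (v y * (v y' * K y' y)))"
  proof (intro sum.cong refl)
    fix y y' assume yy: "y \<in> V" "y' \<in> V"
    have "(\<Sum>i\<in>V. (v y * B i y) * (v y' * B i y')) = v y * v y' * (\<Sum>i\<in>V. B i y * B i y')"
      by (simp add: sum_distrib_left mult_ac)
    thus "(\<Sum>i\<in>V. (v y * B i y) * (v y' * B i y')) * (\<Sum>j\<in>V. B j y * B j y') =
       \<kappa>\<^sup>2 * (v y * (v y' * K y' y))"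
      using B_columns[OF yy] K_B[OF yy(1), of y'] K_sym[OF yy] by (simp add: \<kappa>_def power2_eq_square)
  qed
  also have "\<dots> = (\<Sum>y\<in>V. \<kappa>\<^sup>2 * (v y * H y))"
    by (simp add: H_def sum_distrib_left)
  also have "\<dots> = 0"
  proof (intro sum.neutral ballI)
    fix y
    have "y = x \<or> y = z \<or> adj x y \<or> v y = 0" unfolding v_def by auto
    thus "\<kappa>\<^sup>2 * (v y * H y) = 0" using Hx Hy Hz by auto
  qed
  finally have "R w w = 0"
    using sum_squares_zero[OF finite_V finite_V _ in_V(3) in_V(3), of R] by simp
  moreover have "R w w = H w"
    unfolding R_def H_def
  proof (intro sum.cong refl)
    fix y assume "y \<in> V"
    hence "B w y * B w y = K y w" using K_B[OF in_V(3), of y] K_sym[OF in_V(3)] by metis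
    thus "v y * B w y * B w y = v y * K y w" by (simp only: mult.assoc)
  qed
  ultimately have "H w = 0" by simp
  moreover have "H w = (\<Sum>y\<in>nbrs x. g y * adj_even w y)"
  proof -
    have "K y w = adj_even w y" if "y \<in> nbrs x" for y
    proof -
      have "y \<in> V" using that adj_in2 by simp
      moreover have "w \<noteq> y" "ant w \<noteq> y" using that xw dist2_ant[OF xw] by (auto simp: dist2_def)
      ultimately show ?thesis using in_V K_sym[of y w] by (simp add: K_def id_even_def)
    qed
    thus ?thesis unfolding H using dist2_vals[OF xw] dist2_vals[OF zw] by (simp add: K_def)
  qed
  moreover have "(\<Sum>y\<in>nbrs x. g y * adj_even w y) = 2 * real m - (s + 1) * (\<Sum>y\<in>nbrs x. adj_even z y * adj_even w y)"
    using sum_adj_even_nbrs[OF xw]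
    by (simp add: g_def algebra_simps sum_subtractf sum.distrib sum_distrib_left)
  ultimately have "(s + 1) * (4 * real (card (nbrs x \<inter> nbrs z \<inter> nbrs w))) = (s + 1) * (s\<^sup>2 * (s - 1))"
    unfolding sum_adj_even_adj_even[OF xz xw zw] m2 by (simp add: algebra_simps power2_eq_square)
  thus ?thesis using s_gt by simp
qed

end

section \<open>Eigenfunctions of a graph\<close>

lemma graph_eigenfunction:
  assumes fin: "finite (verts H)" and adj_in: "\<And>x y. x \<rightarrow>\<^bsub>H\<^esub> y \<Longrightarrow> y \<in> verts H"
    and t: "t \<in> graph_eigenvalues H"
  obtains f v0 where "v0 \<in> verts H" "f v0 \<noteq> (0::real)"
    "\<And>x. x \<in> verts H \<Longrightarrow> (\<Sum>y\<in>{y. x \<rightarrow>\<^bsub>H\<^esub> y}. f y) = t * f x"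
proof -
  define xs where "xs = vertex_enum H"
  define n where "n = length xs"
  have "\<exists>xs. distinct xs \<and> set xs = verts H"
    using finite_distinct_list[OF fin] by blast
  hence "distinct xs \<and> set xs = verts H"
    unfolding xs_def vertex_enum_def by (rule someI_ex)
  hence xs: "distinct xs" "set xs = verts H" by auto
  define A where "A = adjacency_matrix H"
  have A: "A = mat n n (\<lambda>(i, j). if xs ! i \<rightarrow>\<^bsub>H\<^esub> xs ! j then 1 else 0)"
    by (simp add: A_def adjacency_matrix_def xs_def n_def Let_def)
  obtain v where v: "v \<in> carrier_vec n" "v \<noteq> 0\<^sub>v n" "A *\<^sub>v v = t \<cdot>\<^sub>v v"
    using t unfolding graph_eigenvalues_def eigenvalue_def eigenvector_def A_def[symmetric] by (auto simp: A)
  have bij: "bij_betw (\<lambda>i. xs ! i) {..<n} (verts H)"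
    using bij_betw_nth[OF xs(1)] xs(2) by (simp add: n_def)
  define idx where "idx = the_inv_into {..<n} (\<lambda>i. xs ! i)"
  define f where "f x = v $ idx x" for x
  have f: "f (xs ! i) = v $ i" if "i < n" for i
    using that bij by (simp add: f_def idx_def the_inv_into_f_f bij_betw_def)
  have "\<exists>i<n. v $ i \<noteq> 0"
  proof (rule ccontr)
    assume "\<not> (\<exists>i<n. v $ i \<noteq> 0)"
    hence "v = 0\<^sub>v n" using v(1) by (intro eq_vecI) auto
    thus False using v(2) by simp
  qed
  then obtain i0 where i0: "i0 < n" "v $ i0 \<noteq> 0" by blast
  have ev: "(\<Sum>y\<in>{y. x \<rightarrow>\<^bsub>H\<^esub> y}. f y) = t * f x" if "x \<in> verts H" for x
  proof -
    obtain i where i: "i < n" "x = xs ! i" using \<open>x \<in> verts H\<close> xs(2) by (metis in_set_conv_nth n_def)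
    have "t * f x = (A *\<^sub>v v) $ i" using i v f by simp
    also have "\<dots> = (\<Sum>j<n. (if xs ! i \<rightarrow>\<^bsub>H\<^esub> xs ! j then 1 else 0) * v $ j)"
      using i v(1) by (simp add: A scalar_prod_def lessThan_atLeast0)
    also have "\<dots> = (\<Sum>j<n. (if x \<rightarrow>\<^bsub>H\<^esub> xs ! j then f (xs ! j) else 0))"
      using i f by (intro sum.cong) auto
    also have "\<dots> = (\<Sum>y\<in>verts H. (if x \<rightarrow>\<^bsub>H\<^esub> y then f y else 0))"
      by (rule sum.reindex_bij_betw[OF bij])
    also have "\<dots> = (\<Sum>y\<in>{y. x \<rightarrow>\<^bsub>H\<^esub> y}. f y)"
      using fin adj_in by (intro sum.mono_neutral_cong_right) auto
    finally show ?thesis by simp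
  qed
  show ?thesis
  proof (rule that)
    show "xs ! i0 \<in> verts H" using i0(1) xs(2) n_def nth_mem by metis
    show "f (xs ! i0) \<noteq> 0" using f i0 by simp
  qed (rule ev)
qed

section \<open>Distances and antipodes in distance-regular double covers\<close>

locale connected_graph = graph G for G :: "('a, 'b) pre_digraph" (structure) +
  assumes conn: "Digraph_Component.connected G"
begin

definition walk_of_length :: "nat \<Rightarrow> 'a \<Rightarrow> 'a \<Rightarrow> bool" where
  "walk_of_length n x y \<longleftrightarrow> (\<exists>p. awalk x p y \<and> length p = n)"

abbreviation "d \<equiv> graph_dist G"

lemma walk_0 [simp]: "walk_of_length 0 x y \<longleftrightarrow> x = y \<and> x \<in> verts G"
  by (auto simp: walk_of_length_def awalk_Nil_iff)

lemma walk_Suc: "walk_of_length (Suc n) x y \<longleftrightarrow> (\<exists>z. x \<rightarrow> z \<and> walk_of_length n z y)"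
proof
  assume "walk_of_length (Suc n) x y"
  then obtain e p where "awalk x (e # p) y" "length p = n"
    unfolding walk_of_length_def length_Suc_conv by blast
  thus "\<exists>z. x \<rightarrow> z \<and> walk_of_length n z y"
    by (auto simp: awalk_Cons_iff walk_of_length_def intro: in_arcs_imp_in_arcs_ends)
next
  assume "\<exists>z. x \<rightarrow> z \<and> walk_of_length n z y"
  then obtain z p where "x \<rightarrow> z" "awalk z p y" "length p = n" by (auto simp: walk_of_length_def)
  moreover from this(1) obtain e where "e \<in> arcs G" "tail G e = x" "head G e = z" by auto
  ultimately have "awalk x (e # p) y" "length (e # p) = Suc n" by (auto simp: awalk_Cons_iff)
  thus "walk_of_length (Suc n) x y" unfolding walk_of_length_def by blast
qed

lemma walk_in_verts: "walk_of_length n x y \<Longrightarrow> x \<in> verts G \<and> y \<in> verts G"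
  by (auto simp: walk_of_length_def)

lemma walk_add: "walk_of_length (m + n) x y \<longleftrightarrow> (\<exists>z. walk_of_length m x z \<and> walk_of_length n z y)"
proof (induction m arbitrary: x)
  case 0
  thus ?case using walk_in_verts by auto
next
  case (Suc m)
  thus ?case by (auto simp: walk_Suc)
qed

lemma adj_1: "walk_of_length 1 x y \<longleftrightarrow> x \<rightarrow> y"
  using walk_Suc[of 0 x y] adj_in_verts by auto

lemma walk_sym: "walk_of_length n x y \<Longrightarrow> walk_of_length n y x"
proof (induction n arbitrary: x)
  case (Suc n)
  then obtain z where z: "x \<rightarrow> z" "walk_of_length n z y" by (auto simp: walk_Suc)
  hence "walk_of_length n y z" "walk_of_length 1 z x" using Suc.IH graph_symmetric adj_1 by auto
  hence "walk_of_length (n + 1) y x" unfolding walk_add by blast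
  thus ?case by simp
qed simp

lemma walk_exists: "x \<in> verts G \<Longrightarrow> y \<in> verts G \<Longrightarrow> \<exists>n. walk_of_length n x y"
  using symmetric_connected_imp_strongly_connected[OF sym_arcs conn]
  unfolding strongly_connected_def reachable_awalk walk_of_length_def by blast

lemma dist_walk: "x \<in> verts G \<Longrightarrow> y \<in> verts G \<Longrightarrow> walk_of_length (d x y) x y"
  unfolding graph_dist_def walk_of_length_def[symmetric] using walk_exists LeastI_ex by metis

lemma dist_le: "walk_of_length n x y \<Longrightarrow> d x y \<le> n"
  unfolding graph_dist_def walk_of_length_def[symmetric] by (rule Least_le)

lemma dist_sym: "x \<in> verts G \<Longrightarrow> y \<in> verts G \<Longrightarrow> d x y = d y x"
  using dist_le[OF walk_sym[OF dist_walk[of x y]]] dist_le[OF walk_sym[OF dist_walk[of y x]]]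
  by simp

lemma dist_triangle:
  "x \<in> verts G \<Longrightarrow> y \<in> verts G \<Longrightarrow> z \<in> verts G \<Longrightarrow> d x z \<le> d x y + d y z"
  using dist_walk walk_add dist_le by blast

lemma dist_0: "x \<in> verts G \<Longrightarrow> y \<in> verts G \<Longrightarrow> d x y = 0 \<longleftrightarrow> x = y"
  using dist_walk[of x y] dist_le[of 0 x y] by auto

lemma dist_self: "x \<in> verts G \<Longrightarrow> d x x = 0"
  by (simp add: dist_0)

lemma dist_1: "x \<in> verts G \<Longrightarrow> y \<in> verts G \<Longrightarrow> d x y = 1 \<longleftrightarrow> x \<rightarrow> y"
proof
  assume xy: "x \<in> verts G" "y \<in> verts G"
  show "d x y = 1 \<Longrightarrow> x \<rightarrow> y" using dist_walk[OF xy] adj_1 by auto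
  assume "x \<rightarrow> y"
  hence "d x y \<le> 1" "x \<noteq> y" using dist_le[of 1 x y] adj_1 adj_not_same by auto
  thus "d x y = 1" using dist_0[OF xy] by linarith
qed

lemma dist_split:
  assumes "x \<in> verts G" "y \<in> verts G" "d x y = m + n"
  obtains z where "z \<in> verts G" "d x z = m" "d z y = n"
proof -
  obtain z where z: "walk_of_length m x z" "walk_of_length n z y"
    using dist_walk[OF assms(1,2)] walk_add assms(3) by auto
  hence "z \<in> verts G" using walk_in_verts by auto
  moreover have "d x z \<le> m" "d z y \<le> n" using z dist_le by auto
  ultimately show ?thesis using that[of z] dist_triangle[of x z y] assms by auto
qed

lemma finite_dists: "finite {d x y |x y. x \<in> verts G \<and> y \<in> verts G}"
proof -
  have "{d x y |x y. x \<in> verts G \<and> y \<in> verts G} = (\<lambda>(x, y). d x y) ` (verts G \<times> verts G)" by auto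
  thus ?thesis by simp
qed

lemma dist_le_diameter: "x \<in> verts G \<Longrightarrow> y \<in> verts G \<Longrightarrow> d x y \<le> graph_diameter G"
  unfolding graph_diameter_def by (intro Max_ge finite_dists) auto

lemma verts_nonempty: "verts G \<noteq> {}"
  using symmetric_connected_imp_strongly_connected[OF sym_arcs conn] by (auto simp: strongly_connected_def)

lemma diameter_attained:
  obtains x y where "x \<in> verts G" "y \<in> verts G" "d x y = graph_diameter G"
proof -
  have "{d x y |x y. x \<in> verts G \<and> y \<in> verts G} \<noteq> {}" using verts_nonempty by auto
  from Max_in[OF finite_dists this] that show ?thesis unfolding graph_diameter_def by auto
qed

lemma sphere_1: "x \<in> verts G \<Longrightarrow> dist_sphere G 1 x = {y. x \<rightarrow> y}"
  unfolding dist_sphere_def using dist_1 adj_in_verts by auto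

end

locale antipodal_drg = connected_graph G for G :: "('a, 'b) pre_digraph" (structure) +
  assumes drg: "distance_regular G" and diam: "graph_diameter G = 4"
    and cover: "antipodal_cover G 2"
begin

lemma dist_le_4: "x \<in> verts G \<Longrightarrow> y \<in> verts G \<Longrightarrow> d x y \<le> 4"
  using dist_le_diameter diam by simp

text \<open>
  Some geodesic has length 4, so the numbers \<open>b_i\<close> with \<open>i < 4\<close> are positive.
\<close>

lemma geodesic_step:
  assumes "u \<in> verts G" "v \<in> verts G" "d u v < 4"
  obtains w where "v \<rightarrow> w" "d u w = d u v + 1"
proof -
  define i where "i = d u v"
  obtain x y where xy: "x \<in> verts G" "y \<in> verts G" "d x y = 4" using diameter_attained diam by metis
  have "d x y = i + (1 + (3 - i))" using assms xy by (simp add: i_def)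
  then obtain z where z: "z \<in> verts G" "d x z = i" "d z y = 1 + (3 - i)"
    using dist_split xy by metis
  then obtain w where w: "w \<in> verts G" "d z w = 1" "d w y = 3 - i" using dist_split xy by metis
  have "d x w = i + 1"
    using dist_triangle[of x z w] dist_triangle[of x w y] z w xy assms by (simp add: i_def)
  hence "w \<in> dist_sphere G (i + 1) x \<inter> dist_sphere G 1 z" using w by (simp add: dist_sphere_def)
  moreover have fin: "finite (dist_sphere G (i + 1) x \<inter> dist_sphere G 1 z)"
    by (simp add: dist_sphere_def)
  ultimately have pos: "card (dist_sphere G (i + 1) x \<inter> dist_sphere G 1 z) > 0"
    by (auto simp only: card_gt_0_iff)
  have "i \<le> graph_diameter G" using assms(3) diam by (simp add: i_def)
  then obtain n where n: "is_b G i n" using drg unfolding distance_regular_def by blast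
  have "card (dist_sphere G (i + 1) x \<inter> dist_sphere G 1 z) = n"
    using n xy(1) z(1,2) unfolding is_b_def by blast
  moreover have "card (dist_sphere G (i + 1) u \<inter> dist_sphere G 1 v) = n"
    using n assms(1,2) i_def unfolding is_b_def by blast
  ultimately have "card (dist_sphere G (i + 1) u \<inter> dist_sphere G 1 v) > 0" using pos by simp
  then obtain w' where "w' \<in> dist_sphere G (i + 1) u \<inter> dist_sphere G 1 v"
    unfolding card_gt_0_iff by blast
  thus ?thesis using that[of w'] assms(2) dist_1[of v w'] by (simp add: dist_sphere_def i_def)
qed

lemma geodesic_extension:
  assumes "u \<in> verts G" "v \<in> verts G"
  obtains w where "w \<in> verts G" "d u w = 4" "d v w = 4 - d u v"
proof -
  have "\<exists>w\<in>verts G. d u w = 4 \<and> d v w \<le> n" if "v \<in> verts G" "4 - d u v = n" for n v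
    using that
  proof (induction n arbitrary: v)
    case 0
    thus ?case using dist_le_4[OF assms(1), of v] dist_self by (intro bexI[of _ v]) auto
  next
    case (Suc n)
    have "d u v < 4" using Suc.prems(2) by simp
    from geodesic_step[OF assms(1) Suc.prems(1) this]
    obtain v' where v': "v \<rightarrow> v'" "d u v' = d u v + 1" .
    have in_V: "v' \<in> verts G" using v'(1) adj_in_verts by auto
    have "4 - d u v' = n" using Suc.prems(2) v'(2) by simp
    from Suc.IH[OF in_V this] obtain w where w: "w \<in> verts G" "d u w = 4" "d v' w \<le> n" by blast
    have "d v w \<le> d v v' + d v' w" by (rule dist_triangle[OF Suc.prems(1) in_V w(1)])
    moreover have "d v v' = 1" using dist_1[OF Suc.prems(1) in_V] v'(1) by simp
    ultimately have "d v w \<le> Suc n" using w(3) by simp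
    thus ?case using w by blast
  qed
  from this[OF assms(2) refl] obtain w where w: "w \<in> verts G" "d u w = 4" "d v w \<le> 4 - d u v" by blast
  have "d v w = 4 - d u v" using dist_triangle[OF assms w(1)] w by simp
  thus ?thesis using that w by blast
qed

definition ant :: "'a \<Rightarrow> 'a" where "ant x = (THE y. y \<in> verts G \<and> d x y = 4)"

lemma ex1_antipode:
  assumes x: "x \<in> verts G"
  shows "\<exists>!y. y \<in> verts G \<and> d x y = 4"
proof -
  let ?C = "{y \<in> verts G. d x y = 0 \<or> d x y = 4}"
  have "antipodal_rel G `` {x} = ?C" using x by (auto simp: antipodal_rel_def diam)
  moreover have "antipodal_rel G `` {x} \<in> verts G // antipodal_rel G" using x by (rule quotientI)
  ultimately have c: "card ?C = 2" using cover unfolding antipodal_cover_def by metis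
  have "?C = insert x {y \<in> verts G. d x y = 4}" using x dist_0 by auto
  moreover have "x \<notin> {y \<in> verts G. d x y = 4}" using x dist_self by auto
  ultimately have "card {y \<in> verts G. d x y = 4} = 1" using c by simp
  then obtain z where "{y \<in> verts G. d x y = 4} = {z}" by (auto simp: card_1_singleton_iff)
  thus ?thesis by (intro ex1I[of _ z]) auto
qed

lemma ant: assumes "x \<in> verts G" shows "ant x \<in> verts G" "d x (ant x) = 4"
  using theI'[OF ex1_antipode[OF assms]] by (auto simp: ant_def)

lemma ant_eqI: "x \<in> verts G \<Longrightarrow> y \<in> verts G \<Longrightarrow> d x y = 4 \<Longrightarrow> ant x = y"
  using ex1_antipode[of x] ant[of x] by metis

text \<open>
  A geodesic from \<open>x\<close> to \<open>y\<close> can be extended until it has length 4, and there it ends in the only vertex at distance 4.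
\<close>

lemma dist_ant:
  assumes "x \<in> verts G" "y \<in> verts G"
  shows "d (ant x) y = 4 - d x y"
proof -
  obtain w where w: "w \<in> verts G" "d x w = 4" "d y w = 4 - d x y"
    using geodesic_extension[OF assms] .
  have "ant x = w" by (rule ant_eqI[OF assms(1) w(1,2)])
  thus ?thesis using w(3) dist_sym[OF assms(2) w(1)] by simp
qed

lemma ant_ant: "x \<in> verts G \<Longrightarrow> ant (ant x) = x"
  using ant_eqI[of "ant x" x] ant[of x] dist_sym[of x "ant x"] by simp

lemma is_drg_parameters:
  obtains k l m where "is_b G 0 k" "is_a G 1 l" "is_c G 2 m"
proof -
  have "0 \<le> graph_diameter G" "1 \<le> graph_diameter G" "2 \<le> graph_diameter G" using diam by auto
  thus ?thesis using that drg unfolding distance_regular_def by metis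
qed

lemma is_cover:
  assumes k: "is_b G 0 k" and l: "is_a G 1 l" and m: "is_c G 2 m"
  shows "antipodal_double_cover (verts G) (\<lambda>x y. x \<rightarrow> y) ant k l m"
proof
  have adj: "x \<rightarrow> y \<longleftrightarrow> x \<in> verts G \<and> y \<in> verts G \<and> d x y = 1" for x y
    using dist_1 adj_in_verts by auto
  have adj_ant: "ant x \<rightarrow> y \<longleftrightarrow> y \<in> verts G \<and> d x y = 3" if "x \<in> verts G" for x y
    using that adj dist_ant[OF that, of y] ant by auto
  show "finite (verts G)" by simp
  show "x \<rightarrow> y \<Longrightarrow> x \<in> verts G" for x y using adj_in_verts by auto
  show "x \<rightarrow> y \<Longrightarrow> y \<rightarrow> x" for x y by (rule graph_symmetric)
  show "\<not> x \<rightarrow> x" for x using adj_not_same by auto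
  show "x \<in> verts G \<Longrightarrow> ant x \<in> verts G" for x by (rule ant)
  show "x \<in> verts G \<Longrightarrow> ant (ant x) = x" for x by (rule ant_ant)
  show "x \<in> verts G \<Longrightarrow> ant x \<noteq> x" for x using ant dist_self by force
  show "x \<rightarrow> y \<Longrightarrow> ant x \<rightarrow> ant y" for x y
    using adj[of x y] adj[of "ant x" "ant y"] dist_ant[of x "ant y"] dist_ant[of y x] dist_sym ant by auto
  show "x \<in> verts G \<Longrightarrow> \<not> x \<rightarrow> ant x" for x using ant adj by auto
  show "\<lbrakk>x \<in> verts G; x \<rightarrow> z\<rbrakk> \<Longrightarrow> \<not> ant x \<rightarrow> z" for x z
    using adj[of x z] adj_ant[of x z] by auto
  show "\<lbrakk>x \<in> verts G; ant x \<rightarrow> y; x \<rightarrow> z\<rbrakk> \<Longrightarrow> \<not> y \<rightarrow> z" for x y z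
    using adj[of x z] adj[of y z] adj_ant[of x y] dist_triangle[of x z y] dist_sym[of y z] by auto
  show "card {z. x \<rightarrow> z} = k" if "x \<in> verts G" for x
  proof -
    have "card (dist_sphere G (0 + 1) x \<inter> dist_sphere G 1 x) = k"
      using k that dist_self[OF that] unfolding is_b_def by blast
    thus ?thesis using sphere_1[OF that] by simp
  qed
  have nb: "dist_sphere G 1 x \<inter> dist_sphere G 1 y = {z. x \<rightarrow> z \<and> y \<rightarrow> z}"
    if "x \<in> verts G" "y \<in> verts G" for x y
    using sphere_1[OF that(1)] sphere_1[OF that(2)] by auto
  show "card {z. x \<rightarrow> z \<and> y \<rightarrow> z} = l" if "x \<rightarrow> y" for x y
    using l that adj[of x y] nb[of x y] unfolding is_a_def by fastforce
  show "card {z. x \<rightarrow> z \<and> y \<rightarrow> z} = m"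
    if "x \<in> verts G" "y \<in> verts G" "y \<noteq> x" "y \<noteq> ant x" "\<not> x \<rightarrow> y" "\<not> ant x \<rightarrow> y" for x y
  proof -
    have "d x y \<noteq> 0" "d x y \<noteq> 1" "d x y \<noteq> 3" "d x y \<noteq> 4" "d x y \<le> 4"
      using that dist_0[of x y] dist_1[of x y] adj_ant[of x y] ant_eqI[of x y] dist_le_4[of x y] by auto
    hence "d x y = 2" by linarith
    hence "card (dist_sphere G (2 - 1) x \<inter> dist_sphere G 1 y) = m"
      using m that unfolding is_c_def by blast
    thus ?thesis using nb[OF that(1,2)] by simp
  qed
qed

lemma exists_dist:
  assumes "n \<le> 4"
  obtains x y where "x \<in> verts G" "y \<in> verts G" "d x y = n"
proof -
  obtain x y where xy: "x \<in> verts G" "y \<in> verts G" "d x y = 4" using diameter_attained diam by metis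
  hence "d x y = n + (4 - n)" using assms by simp
  then obtain z where "z \<in> verts G" "d x z = n" using dist_split xy by metis
  thus ?thesis using that xy by blast
qed

lemma drg_valency_eq: "is_b G 0 k \<Longrightarrow> drg_valency G = k"
  and num_a_eq: "is_a G 1 l \<Longrightarrow> num_a G 1 = l"
  and num_b_eq: "is_b G 1 b \<Longrightarrow> num_b G 1 = b"
proof -
  obtain x0 y0 where 0: "x0 \<in> verts G" "y0 \<in> verts G" "d x0 y0 = 0" using exists_dist[of 0] by auto
  obtain x1 y1 where 1: "x1 \<in> verts G" "y1 \<in> verts G" "d x1 y1 = 1" using exists_dist[of 1] by auto
  show "drg_valency G = k" if k: "is_b G 0 k"
    unfolding num_b_def
  proof (rule the_equality[of "is_b G 0", OF k])
    show "n = k" if "is_b G 0 n" for n using that k 0 unfolding is_b_def by blast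
  qed
  show "num_a G 1 = l" if l: "is_a G 1 l"
    unfolding num_a_def
  proof (rule the_equality[of "is_a G 1", OF l])
    show "n = l" if "is_a G 1 n" for n using that l 1 unfolding is_a_def by blast
  qed
  show "num_b G 1 = b" if b: "is_b G 1 b"
    unfolding num_b_def
  proof (rule the_equality[of "is_b G 1", OF b])
    show "n = b" if "is_b G 1 n" for n using that b 1 unfolding is_b_def by blast
  qed
qed

lemma b1_eq:
  assumes k: "is_b G 0 k" and l: "is_a G 1 l"
  obtains b where "is_b G 1 b" "k = b + l + 1" "b > 0"
proof -
  have "1 \<le> graph_diameter G" using diam by simp
  then obtain b where b: "is_b G 1 b" using drg unfolding distance_regular_def by blast
  obtain x y where xy: "x \<in> verts G" "y \<in> verts G" "d x y = 1" using exists_dist[of 1] by auto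
  let ?S = "\<lambda>i. dist_sphere G i x \<inter> dist_sphere G 1 y"
  have fin: "finite (?S i)" for i by (simp add: dist_sphere_def)
  have cb: "card (?S 2) = b" using b xy unfolding is_b_def by (simp add: numeral_2_eq_2)
  have cl: "card (?S 1) = l" using l xy unfolding is_a_def by blast
  have ck: "card (dist_sphere G 1 y) = k"
    using k xy(2) dist_self[OF xy(2)] unfolding is_b_def by fastforce
  have d: "d y x = 1" using dist_sym[OF xy(1,2)] xy(3) by simp
  have sphere: "dist_sphere G 1 y = insert x (?S 1 \<union> ?S 2)"
  proof -
    have "d x z = 0 \<or> d x z = 1 \<or> d x z = 2" if "z \<in> verts G" "d y z = 1" for z
      using dist_triangle[OF xy(1,2) that(1)] xy(3) that(2) by linarith
    thus ?thesis using xy d dist_0[OF xy(1)] unfolding dist_sphere_def by auto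
  qed
  have nx: "x \<notin> ?S 1 \<union> ?S 2" using dist_self[OF xy(1)] by (auto simp: dist_sphere_def)
  have cU: "card (?S 1 \<union> ?S 2) = l + b"
  proof -
    have "?S 1 \<inter> ?S 2 = {}" by (auto simp: dist_sphere_def)
    from card_Un_disjoint[OF fin fin this] show ?thesis using cb cl by simp
  qed
  have "finite (?S 1 \<union> ?S 2)" using fin by blast
  from card_insert_disjoint[OF this nx] have "card (insert x (?S 1 \<union> ?S 2)) = b + l + 1"
    unfolding cU by simp
  hence "k = b + l + 1" using ck unfolding sphere[symmetric] by simp
  moreover have "b > 0"
  proof -
    obtain w where w: "y \<rightarrow> w" "d x w = d x y + 1" using geodesic_step[of x y] xy by auto
    hence "w \<in> verts G" using adj_in_verts by auto
    hence "w \<in> ?S 2" using w xy dist_1[of y w] by (simp add: dist_sphere_def)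
    hence "card (?S 2) > 0" using fin card_gt_0_iff by blast
    thus ?thesis using cb by simp
  qed
  ultimately show ?thesis using that b by blast
qed

lemma c2_pos:
  assumes m: "is_c G 2 m"
  shows "m > 0"
proof -
  obtain x y where xy: "x \<in> verts G" "y \<in> verts G" "d x y = 2" using exists_dist[of 2] by auto
  have "d x y = 1 + 1" using xy(3) by simp
  from dist_split[OF xy(1,2) this] obtain z where z: "z \<in> verts G" "d x z = 1" "d z y = 1" .
  hence "z \<in> dist_sphere G (2 - 1) x \<inter> dist_sphere G 1 y"
    using dist_sym[OF z(1) xy(2)] by (simp add: dist_sphere_def)
  moreover have "finite (dist_sphere G (2 - 1) x \<inter> dist_sphere G 1 y)" by (simp add: dist_sphere_def)
  moreover have "card (dist_sphere G (2 - 1) x \<inter> dist_sphere G 1 y) = m"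
    using m xy unfolding is_c_def by blast
  ultimately show ?thesis using card_gt_0_iff by blast
qed

end


section \<open>The parameters of a tight graph\<close>

lemma quadratic_two_roots:
  fixes x y u v :: real
  assumes "x\<^sup>2 - u * x - v = 0" "y\<^sup>2 - u * y - v = 0" "x \<noteq> y"
  shows "u = x + y" "v = - x * y"
proof -
  have "(x - y) * (x + y - u) = 0" using assms(1,2) by (simp add: algebra_simps power2_eq_square)
  thus u: "u = x + y" using assms(3) by simp
  show "v = - x * y" using assms(1) unfolding u by (simp add: algebra_simps power2_eq_square)
qed

text \<open>
  With \<open>f = t^2 - l t - k\<close>, the second quadratic is \<open>g = f + 2 m (t + 1)\<close>. As \<open>f\<close> is negative at \<open>-1\<close>, this point lies
  between the roots of \<open>f\<close>; so \<open>g\<close> is positive at the larger and negative at the smaller root of \<open>f\<close>.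
\<close>

lemma interlacing:
  fixes k l m a b c e :: real
  assumes b1: "k - 1 - l > 0" and m: "m > 0"
    and f: "a\<^sup>2 - l * a - k = 0" "b\<^sup>2 - l * b - k = 0" "a > b"
    and g: "c\<^sup>2 - (l - 2 * m) * c - (k - 2 * m) = 0" "e\<^sup>2 - (l - 2 * m) * e - (k - 2 * m) = 0" "c > e"
  shows "a > c" "c > b" "b > e" "b < - 1"
proof -
  have r: "l = a + b" "k = - a * b" "l - 2 * m = c + e" "k - 2 * m = - c * e"
    using quadratic_two_roots[OF f(1,2)] quadratic_two_roots[OF g(1,2)] f(3) g(3) by auto
  have "(a + 1) * (b + 1) < 0" using b1 unfolding r by (simp add: algebra_simps)
  hence ab: "a + 1 > 0" "b + 1 < 0" using f(3) by (auto simp: mult_less_0_iff)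
  thus "b < - 1" by simp
  have ga: "(t - c) * (t - e) = (t - a) * (t - b) + 2 * m * (t + 1)" for t
  proof -
    have "(t - c) * (t - e) = t\<^sup>2 - (c + e) * t + c * e" by (simp add: algebra_simps power2_eq_square)
    also have "\<dots> = t\<^sup>2 - (a + b - 2 * m) * t + (a * b + 2 * m)" using r by simp
    finally show ?thesis by (simp add: algebra_simps power2_eq_square)
  qed
  have "2 * m * (a + 1) > 0" using m ab by (intro mult_pos_pos) auto
  hence pa: "(a - c) * (a - e) > 0" using ga[of a] by simp
  have "2 * m * (b + 1) < 0" using m ab by (intro mult_pos_neg) auto
  hence "(b - c) * (b - e) < 0" using ga[of b] by simp
  thus cb: "c > b" "b > e" using g(3) by (auto simp: mult_less_0_iff)
  show "a > c" using pa cb f(3) by (auto simp: zero_less_mult_iff)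
qed

text \<open>
  Each quadratic has at most two roots, so each has exactly two among the four numbers, and of the six ways to
  distribute them only one interlaces.
\<close>

lemma eigenvalue_order:
  fixes k l m t1 t2 t3 t4 :: real
  assumes b1: "k - 1 - l > 0" and m: "m > 0"
    and ord: "t1 > t2" "t2 > t3" "t3 > t4"
    and roots: "\<And>t. t \<in> {t1, t2, t3, t4} \<Longrightarrow>
       t\<^sup>2 - l * t - k = 0 \<or> t\<^sup>2 - (l - 2 * m) * t - (k - 2 * m) = 0"
  shows "t1\<^sup>2 - l * t1 - k = 0" "t3\<^sup>2 - l * t3 - k = 0"
    "t2\<^sup>2 - (l - 2 * m) * t2 - (k - 2 * m) = 0" "t4\<^sup>2 - (l - 2 * m) * t4 - (k - 2 * m) = 0"
proof -
  define f where "f t \<longleftrightarrow> t\<^sup>2 - l * t - k = 0" for t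
  define g where "g t \<longleftrightarrow> t\<^sup>2 - (l - 2 * m) * t - (k - 2 * m) = 0" for t
  have f3: "\<not> (f x \<and> f y \<and> f z)" if "x > y" "y > z" for x y z
    using quadratic_two_roots(1)[of x l k y] quadratic_two_roots(1)[of x l k z] that unfolding f_def by force
  have g3: "\<not> (g x \<and> g y \<and> g z)" if "x > y" "y > z" for x y z
    using quadratic_two_roots(1)[of x "l - 2 * m" "k - 2 * m" y]
      quadratic_two_roots(1)[of x "l - 2 * m" "k - 2 * m" z] that unfolding g_def by force
  have inter: "a > c \<and> c > b \<and> b > e" if "f a" "f b" "a > b" "g c" "g e" "c > e" for a b c e
    using interlacing[OF b1 m, of a b c e] that unfolding f_def g_def by blast
  have fg: "f t1 \<or> g t1" "f t2 \<or> g t2" "f t3 \<or> g t3" "f t4 \<or> g t4"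
    using roots unfolding f_def g_def by auto
  have t: "t1 > t3" "t1 > t4" "t2 > t4" using ord by auto
  have n: "\<not> (f t1 \<and> f t2 \<and> f t3)" "\<not> (f t1 \<and> f t2 \<and> f t4)" "\<not> (f t1 \<and> f t3 \<and> f t4)" "\<not> (f t2 \<and> f t3 \<and> f t4)"
    "\<not> (g t1 \<and> g t2 \<and> g t3)" "\<not> (g t1 \<and> g t2 \<and> g t4)" "\<not> (g t1 \<and> g t3 \<and> g t4)" "\<not> (g t2 \<and> g t3 \<and> g t4)"
    using f3 g3 ord t by blast+
  have i1: "\<not> (f t1 \<and> f t2 \<and> g t3 \<and> g t4)" using inter[of t1 t2 t3 t4] ord by auto
  have i2: "\<not> (f t1 \<and> f t4 \<and> g t2 \<and> g t3)" using inter[of t1 t4 t2 t3] ord t by auto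
  have i3: "\<not> (f t2 \<and> f t3 \<and> g t1 \<and> g t4)" using inter[of t2 t3 t1 t4] ord t by auto
  have i4: "\<not> (f t2 \<and> f t4 \<and> g t1 \<and> g t3)" using inter[of t2 t4 t1 t3] ord t by auto
  have i5: "\<not> (f t3 \<and> f t4 \<and> g t1 \<and> g t2)" using inter[of t3 t4 t1 t2] ord t by auto
  have "f t1 \<and> f t3 \<and> g t2 \<and> g t4" using fg n i1 i2 i3 i4 i5 by blast
  thus "t1\<^sup>2 - l * t1 - k = 0" "t3\<^sup>2 - l * t3 - k = 0"
    "t2\<^sup>2 - (l - 2 * m) * t2 - (k - 2 * m) = 0" "t4\<^sup>2 - (l - 2 * m) * t4 - (k - 2 * m) = 0"
    by (simp_all add: f_def g_def)
qed

text \<open>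
  By Vieta everything is a function of \<open>s = - t3\<close>, \<open>t1\<close> and \<open>m\<close>. The tightness equation is linear in \<open>t4\<close> and reduces to
  \<open>t4 = - s^2\<close>; the remaining parameters follow from \<open>(1 + t2) (1 + t4) = - b_1\<close>.
\<close>

lemma tight_parameters:
  fixes k l m t1 t2 t3 t4 :: real
  assumes b1: "k - 1 - l > 0" and m: "m > 0" and l: "l \<ge> 0"
    and f: "t1\<^sup>2 - l * t1 - k = 0" "t3\<^sup>2 - l * t3 - k = 0" "t1 > t3"
    and g: "t2\<^sup>2 - (l - 2 * m) * t2 - (k - 2 * m) = 0" "t4\<^sup>2 - (l - 2 * m) * t4 - (k - 2 * m) = 0" "t2 > t4"
    and tight: "(t1 + k / (l + 1)) * (t4 + k / (l + 1)) = - (k * l * (k - 1 - l) / (l + 1)\<^sup>2)"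
  shows "- t3 > 1" "t2 \<ge> 0" "l = t2 * (- t3 + 1)" "k = - t3 * (t2 * (- t3) + t2 + (- t3))"
    "2 * m = - t3 * (t2 + (- t3))"
proof -
  define s where "s = - t3"
  have s1: "s > 1" using interlacing(4)[OF b1 m f g] by (simp add: s_def)
  have r: "l = t1 - s" "k = s * t1" "l - 2 * m = t2 + t4" "k - 2 * m = - t2 * t4"
    using quadratic_two_roots[OF f(1,2)] quadratic_two_roots[OF g(1,2)] f(3) g(3) by (auto simp: s_def)
  have b1': "k - 1 - l = (s - 1) * (t1 + 1)" unfolding r(1,2) by (simp add: algebra_simps)
  have t1: "t1 > 0" using r(1) l s1 by simp
  have "(t1 * (l + 1) + k) * (t4 * (l + 1) + k) = (l + 1)\<^sup>2 * ((t1 + k / (l + 1)) * (t4 + k / (l + 1)))"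
  proof -
    have "t * (l + 1) + k = (l + 1) * (t + k / (l + 1))" for t
      using l by (simp add: field_simps)
    thus ?thesis by (simp only: power2_eq_square mult_ac)
  qed
  also have "\<dots> = - (k * l * (k - 1 - l))"
    unfolding tight using l by simp
  also have "\<dots> = - (t1 * (t1 + 1)) * (s * (t1 - s) * (s - 1))"
    unfolding b1' r(1,2) by (simp add: algebra_simps)
  also have "t1 * (l + 1) + k = t1 * (t1 + 1)" unfolding r(1,2) by (simp add: algebra_simps)
  finally have "(t1 * (t1 + 1)) * (t4 * (l + 1) + k + s * (t1 - s) * (s - 1)) = 0"
    by (simp only: distrib_left[of "t1 * (t1 + 1)"]) simp
  hence "t4 * (l + 1) + k + s * (t1 - s) * (s - 1) = 0" using t1 by auto
  hence "(l + 1) * (t4 + s\<^sup>2) = 0" unfolding r(1,2) by (simp add: algebra_simps power2_eq_square)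
  hence t4: "t4 = - s\<^sup>2" using l by auto
  have "(1 + t2) * (1 + t4) = 1 + (l - 2 * m) - (k - 2 * m)" unfolding r(3,4) by (simp add: algebra_simps)
  also have "\<dots> = - (s - 1) * (t1 + 1)" using b1' by (simp add: algebra_simps)
  finally have "(s - 1) * ((1 + t2) * (1 + s) - (t1 + 1)) = 0" unfolding t4 by (simp add: algebra_simps power2_eq_square)
  hence e: "(1 + t2) * (1 + s) = t1 + 1" using s1 by simp
  hence lt: "l = t2 * (s + 1)" unfolding r(1) by (simp add: algebra_simps)
  have t1': "t1 = t2 * s + t2 + s" using e by (simp add: algebra_simps)
  have "t2 \<ge> 0" using l s1 unfolding lt by (simp add: zero_le_mult_iff)
  moreover have "k = s * (t2 * s + t2 + s)" unfolding r(2) t1' by simp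
  moreover have "2 * m = s * (t2 + s)" using r(3) unfolding lt t4 by (simp add: algebra_simps power2_eq_square)
  ultimately show "- t3 > 1" "t2 \<ge> 0" "l = t2 * (- t3 + 1)" "k = - t3 * (t2 * (- t3) + t2 + (- t3))"
    "2 * m = - t3 * (t2 + (- t3))" using s1 lt unfolding s_def by auto
qed

lemma induce_subgraph_dominates: "y \<rightarrow>\<^bsub>G \<restriction> S\<^esub> z \<longleftrightarrow> y \<in> S \<and> z \<in> S \<and> y \<rightarrow>\<^bsub>G\<^esub> z"
  by (auto simp: arcs_ends_conv intro!: rev_image_eqI)

text \<open>
  Tightness gives the parameters in terms of \<open>s = - \<theta> 3\<close> and \<open>\<tau> = \<theta> 2\<close>. The local eigenvalues \<open>p\<close> and \<open>-q\<close> lie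
  in \<open>{\<tau>, -s}\<close>, and \<open>p > -q\<close> decides which is which.
\<close>

lemma AT4_tight_double_cover:
  fixes G :: "('a, 'b) pre_digraph"
  assumes "AT4 G p q 2"
  obtains ant k l m where "tight_double_cover (verts G) (\<lambda>x y. x \<rightarrow>\<^bsub>G\<^esub> y) ant k l m q p" "verts G \<noteq> {}"
proof -
  have drg: "distance_regular G" and diam: "graph_diameter G = 4" and cover: "antipodal_cover G 2"
    and pq: "p > - q"
    and loc: "\<And>x. x \<in> verts G \<Longrightarrow> graph_eigenvalues (local_graph G x) - {real (num_a G 1)} = {p, - q}"
    using assms by (auto simp: AT4_def tight_def)
  interpret graph G using drg by (simp add: distance_regular_def)
  interpret antipodal_drg G
    by unfold_locales (use drg diam cover in \<open>simp_all add: distance_regular_def\<close>)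
  obtain k l m where k: "is_b G 0 k" and l: "is_a G 1 l" and m: "is_c G 2 m" by (rule is_drg_parameters)
  interpret C: antipodal_double_cover "verts G" "\<lambda>x y. x \<rightarrow>\<^bsub>G\<^esub> y" ant k l m by (rule is_cover[OF k l m])
  obtain b where b: "is_b G 1 b" "k = b + l + 1" "b > 0" by (rule b1_eq[OF k l])
  have m0: "m > 0" by (rule c2_pos[OF m])
  obtain \<theta> :: "nat \<Rightarrow> real" where \<theta>: "\<theta> 0 = real k" "\<And>i. i < 4 \<Longrightarrow> \<theta> (i + 1) < \<theta> i"
      "graph_eigenvalues G = \<theta> ` {..4}"
      "(\<theta> 1 + real k / (real l + 1)) * (\<theta> 4 + real k / (real l + 1)) = - (real k * real l * real b / (real l + 1)\<^sup>2)"
    using assms unfolding AT4_def tight_def Let_def diam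
      drg_valency_eq[OF k] num_a_eq[OF l] num_b_eq[OF b(1)] by blast
  have ord: "\<theta> 1 < \<theta> 0" "\<theta> 2 < \<theta> 1" "\<theta> 3 < \<theta> 2" "\<theta> 4 < \<theta> 3"
  proof -
    show "\<theta> 2 < \<theta> 1" using \<theta>(2)[of 1] unfolding one_add_one by simp
  qed (use \<theta>(2)[of 0] \<theta>(2)[of 2] \<theta>(2)[of 3] in simp_all)
  have root: "t\<^sup>2 - real l * t - real k = 0 \<or> t\<^sup>2 - (real l - 2 * real m) * t - (real k - 2 * real m) = 0"
    if t: "t \<in> {\<theta> 1, \<theta> 2, \<theta> 3, \<theta> 4}" for t
  proof -
    have "t \<in> graph_eigenvalues G" using t unfolding \<theta>(3) by auto
    then obtain f v0 where "v0 \<in> verts G" "f v0 \<noteq> 0"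
      "\<And>x. x \<in> verts G \<Longrightarrow> (\<Sum>y\<in>{y. x \<rightarrow>\<^bsub>G\<^esub> y}. f y) = t * f x"
      using graph_eigenfunction[of G t] adj_in_verts by (metis finite_verts)
    note f = this
    have "t = real k \<or> t\<^sup>2 - real l * t - real k = 0 \<or>
       t\<^sup>2 - (real l - 2 * real m) * t - (real k - 2 * real m) = 0"
      by (rule C.eigenvalue_cases[of f t v0]) (use f in \<open>auto simp: C.nbrs_def\<close>)
    moreover have "t \<noteq> real k" using t ord \<theta>(1) by auto
    ultimately show ?thesis by blast
  qed
  have b1: "real k - 1 - real l = real b" using b(2) by simp
  have b1': "real k - 1 - real l > 0" using b1 b(3) by simp
  have m0': "real m > 0" using m0 by simp
  note roots = eigenvalue_order[OF b1' m0' ord(2,3,4) root]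
  define s where "s = - \<theta> 3"
  have par: "s > 1" "\<theta> 2 \<ge> 0" "real l = \<theta> 2 * (s + 1)" "real k = s * (\<theta> 2 * s + \<theta> 2 + s)" "2 * real m = s * (\<theta> 2 + s)"
    using tight_parameters[OF b1' m0' _ roots(1,2) _ roots(3,4)] ord \<theta>(4) b1 unfolding s_def by auto
  interpret T: tight_double_cover "verts G" "\<lambda>x y. x \<rightarrow>\<^bsub>G\<^esub> y" ant k l m s "\<theta> 2"
    by unfold_locales (fact par)+
  obtain x where x: "x \<in> verts G" using verts_nonempty by auto
  let ?H = "local_graph G x"
  have H: "verts ?H = {y. x \<rightarrow>\<^bsub>G\<^esub> y}" using sphere_1[OF x] by (simp add: local_graph_def)
  have Hadj: "y \<rightarrow>\<^bsub>?H\<^esub> z \<longleftrightarrow> x \<rightarrow>\<^bsub>G\<^esub> y \<and> x \<rightarrow>\<^bsub>G\<^esub> z \<and> y \<rightarrow>\<^bsub>G\<^esub> z" for y z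
    unfolding local_graph_def sphere_1[OF x] induce_subgraph_dominates by simp
  have cases: "t = \<theta> 2 \<or> t = - s" if t: "t \<in> {p, - q}" for t
  proof -
    have tl: "t \<in> graph_eigenvalues ?H" "t \<noteq> real l" using loc[OF x] t unfolding num_a_eq[OF l] by blast+
    have fin: "finite (verts ?H)" unfolding H using C.finite_nbrs[of x] by (simp add: C.nbrs_def)
    obtain f v0 where f: "v0 \<in> verts ?H" "f v0 \<noteq> 0"
      "\<And>y. y \<in> verts ?H \<Longrightarrow> (\<Sum>z\<in>{z. y \<rightarrow>\<^bsub>?H\<^esub> z}. f z) = t * f y"
      using graph_eigenfunction[OF fin _ tl(1)] Hadj H by (metis mem_Collect_eq)
    show ?thesis
    proof (rule T.local_eigenvalue[OF x, of f t v0])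
      show "x \<rightarrow>\<^bsub>G\<^esub> v0" "f v0 \<noteq> 0" "t \<noteq> real l" using f(1,2) H tl(2) by simp_all
      fix y assume y: "x \<rightarrow>\<^bsub>G\<^esub> y"
      have "C.nbrs x \<inter> C.nbrs y = {z. y \<rightarrow>\<^bsub>?H\<^esub> z}" using y by (auto simp: C.nbrs_def Hadj)
      thus "sum f (C.nbrs x \<inter> C.nbrs y) = t * f y" using f(3)[of y] y H by simp
    qed
  qed
  have "p = \<theta> 2" "q = s" using cases[of p] cases[of "- q"] pq par(1,2) by auto
  thus ?thesis using that T.tight_double_cover_axioms verts_nonempty by auto
qed

section \<open>Nonexistence\<close>

theorem corollary4p6:
  fixes q :: int
  assumes "[q = 3] (mod 4)"
  shows "(\<nexists>G :: ('a, 'b) pre_digraph. AT4 G (real_of_int (q ^ 3 - q ^ 2 - q)) (real_of_int q) 2) \<and>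
         (\<nexists>G :: ('a, 'b) pre_digraph. AT4 G (real_of_int (q ^ 3 - 2 * q)) (real_of_int q) 2)"
proof (intro conjI notI)
  from assms have "q mod 4 = 3" by (simp add: cong_def)
  define j where "j = q div 4"
  have q: "q = 4 * j + 3" using \<open>q mod 4 = 3\<close> unfolding j_def by presburger
  {
    assume "\<exists>G :: ('a, 'b) pre_digraph. AT4 G (real_of_int (q ^ 3 - q ^ 2 - q)) (real_of_int q) 2"
    then obtain G :: "('a, 'b) pre_digraph" where "AT4 G (real_of_int (q ^ 3 - q ^ 2 - q)) (real_of_int q) 2" ..
    then obtain ant k l m where T: "tight_double_cover (verts G) (\<lambda>x y. x \<rightarrow>\<^bsub>G\<^esub> y) ant k l m
        (real_of_int q) (real_of_int (q ^ 3 - q ^ 2 - q))" "verts G \<noteq> {}"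
      by (rule AT4_tight_double_cover)
    interpret tight_double_cover "verts G" "\<lambda>x y. x \<rightarrow>\<^bsub>G\<^esub> y" ant k l m
      "real_of_int q" "real_of_int (q ^ 3 - q ^ 2 - q)" by (rule T(1))
    have "q \<ge> 2" using s_gt by linarith
    obtain y where "y \<in> verts G" using T(2) by auto
    then obtain x z where xz: "dist2 x z" using obtain_local_coclique \<open>q \<ge> 2\<close> by (metis of_int_numeral of_int_le_iff)
    \<comment> \<open>the common neighbours of \<open>x\<close> and \<open>z\<close> induce a regular graph with both order and valency odd\<close>
    define n where "n = nat (q ^ 3 - q ^ 2 - q)"
    have "q ^ 3 - q ^ 2 - q \<ge> 0" using tau_ge by linarith
    hence n: "int n = q ^ 3 - q ^ 2 - q" by (simp add: n_def)
    hence "real_of_int (q ^ 3 - q ^ 2 - q) = real n" by (metis of_int_of_nat_eq)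
    hence ev: "even (m * n)" by (rule mu_graph_parity[OF xz])
    have "real_of_int (2 * int m) = real_of_int (q * ((q ^ 3 - q ^ 2 - q) + q))" using m_eq by simp
    hence "2 * int m = q * ((q ^ 3 - q ^ 2 - q) + q)" by (simp only: of_int_eq_iff)
    hence "int m = q ^ 3 * (2 * j + 1)" unfolding q by (simp add: algebra_simps power2_eq_square power3_eq_cube)
    hence "odd (int m)" using q by simp
    moreover have "odd (int n)" unfolding n using q by simp
    ultimately show False using ev by simp
  next
    assume "\<exists>G :: ('a, 'b) pre_digraph. AT4 G (real_of_int (q ^ 3 - 2 * q)) (real_of_int q) 2"
    then obtain G :: "('a, 'b) pre_digraph" where "AT4 G (real_of_int (q ^ 3 - 2 * q)) (real_of_int q) 2" ..
    then obtain ant k l m where T: "tight_double_cover (verts G) (\<lambda>x y. x \<rightarrow>\<^bsub>G\<^esub> y) ant k l m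
        (real_of_int q) (real_of_int (q ^ 3 - 2 * q))" "verts G \<noteq> {}"
      by (rule AT4_tight_double_cover)
    interpret tight_double_cover "verts G" "\<lambda>x y. x \<rightarrow>\<^bsub>G\<^esub> y" ant k l m
      "real_of_int q" "real_of_int (q ^ 3 - 2 * q)" by (rule T(1))
    have "q \<ge> 2" using s_gt by linarith
    obtain y where "y \<in> verts G" using T(2) by auto
    then obtain x z w where xzw: "dist2 x z" "dist2 x w" "dist2 z w"
      using obtain_local_coclique \<open>q \<ge> 2\<close> by (metis of_int_numeral of_int_le_iff)
    \<comment> \<open>\<open>4 e\<close> would have to be \<open>q^2 (q - 1)\<close>, which is 2 modulo 4\<close>
    define e where "e = card (nbrs x \<inter> nbrs z \<inter> nbrs w)"
    have "real_of_int (q ^ 3 - 2 * q) + real_of_int q = real_of_int q * ((real_of_int q)\<^sup>2 - 1)"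
      by (simp add: algebra_simps power2_eq_square power3_eq_cube)
    from triple_intersection[OF this xzw] have "real_of_int (4 * int e) = real_of_int (q\<^sup>2 * (q - 1))"
      unfolding e_def[symmetric] by simp
    hence "4 * int e = q\<^sup>2 * (q - 1)" by (simp only: of_int_eq_iff)
    hence "2 * int e = q\<^sup>2 * (2 * j + 1)" unfolding q by (simp add: algebra_simps power2_eq_square)
    moreover have "odd (q\<^sup>2 * (2 * j + 1))" using q by simp
    ultimately show False by (metis dvd_triv_left)
  }
qed

end
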